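(* Let $X$ be a compact Hermitian manifold. For any $\mathbb{C}$-invariant closed subset $\mathcal{N}\subset\mathcal{M}(X)$, \[ \rho(\mathcal{N})=\lim_{R\to\infty}\left(\frac{1}{\pi R^2}\sup_{f\in\mathcal{N}}\int_{|z|<R}|df|^2\,dx\,dy\right). \]
   Context: Let $z=x+y\sqrt{-1}$ be the standard coordinate of $\mathbb{C}$. Let $X$ be a compact Hermitian manifold with Kähler form $\omega$ (the positive $(1,1)$-form associated with the Hermitian metric; it is not assumed closed). For a holomorphic map $f:\mathbb{C}\to X$ the spherical derivative $|df|(z)\ge 0$ is defined by $f^*\omega=|df|^2\,dx\,dy$. The map $f$ is called a Brody curve if $|df|(z)\le 1$ for all $z\in\mathbb{C}$. $\mathcal{M}(X)$ is the space of all Brody curves in $X$, with the compact-open topology; it carries the continuous $\mathbb{C}$-action $\mathbb{C}\times\mathcal{M}(X)\to\mathcal{M}(X)$, $(a,f(z))\mapsto f(z+a)$. Closedness and $\mathbb{C}$-invariance are with respect to this topology and this action. For $f\in\mathcal{M}(X)$ the energy density is \[ \rho(f):=\lim_{R\to\infty}\left(\frac{1}{\pi R^2}\sup_{a\in\mathbb{C}}\int_{|z-a|<R}|df|^2\,dx\,dy\right) \] (this limit always exists). For a $\mathbb{C}$-invariant closed subset $\mathcal{N}\subset\mathcal{M}(X)$, $\rho(\mathcal{N}):=\sup_{f\in\mathcal{N}}\rho(f)$. *)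

theory Defs
  imports "HOL-Complex_Analysis.Complex_Analysis"
begin

section \<open>Smooth functions and holomorphic maps in several variables\<close>

primrec C_k_on :: "nat \<Rightarrow> 'v::euclidean_space set \<Rightarrow> ('v \<Rightarrow> 'w::real_normed_vector) \<Rightarrow> bool" where
  "C_k_on 0 S f \<longleftrightarrow> continuous_on S f"
| "C_k_on (Suc k) S f \<longleftrightarrow> (\<forall>x\<in>S. f differentiable (at x)) \<and>
     (\<forall>b\<in>Basis. C_k_on k S (\<lambda>x. frechet_derivative f (at x) b))"

definition C_infinity_on :: "'v::euclidean_space set \<Rightarrow> ('v \<Rightarrow> 'w::real_normed_vector) \<Rightarrow> bool" where
  "C_infinity_on S f \<longleftrightarrow> (\<forall>k. C_k_on k S f)"

definition holomorphic_map_on :: "(complex^'n) set \<Rightarrow> (complex^'n \<Rightarrow> complex^'m) \<Rightarrow> bool" where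
  "holomorphic_map_on S F \<longleftrightarrow>
     (\<forall>p\<in>S. \<exists>D. (F has_derivative D) (at p) \<and> (\<forall>c v. D (c *s v) = c *s D v))"


section \<open>Complex manifolds\<close>

text \<open>A chart is its domain together with its coordinate map; the values of the map outside
  the domain play no role.\<close>

type_synonym ('a, 'n) chart = "'a set \<times> ('a \<Rightarrow> complex^'n)"

definition is_chart :: "'a topology \<Rightarrow> ('a, 'n::finite) chart \<Rightarrow> bool" where
  "is_chart X c \<longleftrightarrow> (case c of (U, \<phi>) \<Rightarrow>
     openin X U \<and> open (\<phi> ` U) \<and>
     homeomorphic_map (subtopology X U) (top_of_set (\<phi> ` U)) \<phi>)"

definition transition :: "('a, 'n) chart \<Rightarrow> ('a, 'n) chart \<Rightarrow> complex^'n \<Rightarrow> complex^'n" where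
  "transition c d = snd d \<circ> the_inv_into (fst c) (snd c)"

locale complex_manifold =
  fixes X :: "'a topology" and A :: "('a, 'n::finite) chart set"
  assumes Hausdorff: "Hausdorff_space X"
    and second_countable: "second_countable X"
    and charts: "c \<in> A \<Longrightarrow> is_chart X c"
    and cover: "(\<Union>c\<in>A. fst c) = topspace X"
    and compatible: "c \<in> A \<Longrightarrow> d \<in> A \<Longrightarrow>
          holomorphic_map_on (snd c ` (fst c \<inter> fst d)) (transition c d)"


section \<open>Hermitian metrics\<close>

definition hermitian_form :: "complex^'n^'n \<Rightarrow> complex^'n \<Rightarrow> complex^'n \<Rightarrow> complex" where
  "hermitian_form H u v = (\<Sum>i\<in>UNIV. \<Sum>j\<in>UNIV. H $ i $ j * u $ i * cnj (v $ j))"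

text \<open>A Hermitian metric \<open>h\<close> is given by its coefficient matrices: \<open>h c p\<close> is the matrix of the
  metric at the point with coordinates \<open>p\<close> in the chart \<open>c\<close>. The tangent space at that point
  is identified with the coordinate space by the chart.\<close>

locale hermitian_manifold = complex_manifold X A
  for X :: "'a topology" and A :: "('a, 'n::finite) chart set" +
  fixes h :: "('a, 'n) chart \<Rightarrow> complex^'n \<Rightarrow> complex^'n^'n"
  assumes smooth: "c \<in> A \<Longrightarrow> C_infinity_on (snd c ` fst c) (\<lambda>p. h c p $ i $ j)"
    and hermitian: "c \<in> A \<Longrightarrow> p \<in> snd c ` fst c \<Longrightarrow> h c p $ j $ i = cnj (h c p $ i $ j)"
    and positive: "c \<in> A \<Longrightarrow> p \<in> snd c ` fst c \<Longrightarrow> v \<noteq> 0 \<Longrightarrow>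
          0 < Re (hermitian_form (h c p) v v)"
    and coordinate_change: "c \<in> A \<Longrightarrow> d \<in> A \<Longrightarrow> x \<in> fst c \<inter> fst d \<Longrightarrow>
          hermitian_form (h c (snd c x)) u v =
          hermitian_form (h d (snd d x))
            (frechet_derivative (transition c d) (at (snd c x)) u)
            (frechet_derivative (transition c d) (at (snd c x)) v)"

locale compact_hermitian_manifold = hermitian_manifold X A h
  for X :: "'a topology" and A :: "('a, 'n::finite) chart set" and h +
  assumes compact: "compact_space X"

text \<open>This is \<open>\<omega> = (\<i>/2) \<Sum> H\<^sub>i\<^sub>j dz\<^sub>i \<and> d\<bar>z\<^sub>j\<close>, evaluated on a pair of
  tangent vectors.\<close>

definition kaehler_form :: "complex^'n^'n \<Rightarrow> complex^'n \<Rightarrow> complex^'n \<Rightarrow> real" where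
  "kaehler_form H u v = - Im (hermitian_form H u v)"


section \<open>Brody curves\<close>

definition holomorphic_curve :: "'a topology \<Rightarrow> ('a, 'n::finite) chart set \<Rightarrow> (complex \<Rightarrow> 'a) \<Rightarrow> bool" where
  "holomorphic_curve X A f \<longleftrightarrow> continuous_map euclidean X f \<and>
     (\<forall>c\<in>A. \<forall>i. (\<lambda>z. snd c (f z) $ i) holomorphic_on (f -` fst c))"

text \<open>The pullback by \<open>f\<close> of the Kaehler form at the point \<open>z\<close>, computed in a chart around \<open>f z\<close>.\<close>

definition pullback_kaehler ::
  "(('a, 'n::finite) chart \<Rightarrow> complex^'n \<Rightarrow> complex^'n^'n) \<Rightarrow> ('a, 'n) chart \<Rightarrow>
   (complex \<Rightarrow> 'a) \<Rightarrow> complex \<Rightarrow> complex \<Rightarrow> complex \<Rightarrow> real" where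
  "pullback_kaehler h c f z u v = kaehler_form (h c (snd c (f z)))
     (frechet_derivative (snd c \<circ> f) (at z) u)
     (frechet_derivative (snd c \<circ> f) (at z) v)"

definition dx_wedge_dy :: "complex \<Rightarrow> complex \<Rightarrow> real" where
  "dx_wedge_dy u v = Re u * Im v - Im u * Re v"

definition spherical_derivative ::
  "('a, 'n::finite) chart set \<Rightarrow> (('a, 'n) chart \<Rightarrow> complex^'n \<Rightarrow> complex^'n^'n) \<Rightarrow>
   (complex \<Rightarrow> 'a) \<Rightarrow> complex \<Rightarrow> real" where
  "spherical_derivative A h f z = (THE r. 0 \<le> r \<and>
     (\<forall>c\<in>A. f z \<in> fst c \<longrightarrow>
        (\<forall>u v. pullback_kaehler h c f z u v = r\<^sup>2 * dx_wedge_dy u v)))"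

definition brody_curves ::
  "'a topology \<Rightarrow> ('a, 'n::finite) chart set \<Rightarrow> (('a, 'n) chart \<Rightarrow> complex^'n \<Rightarrow> complex^'n^'n) \<Rightarrow>
   (complex \<Rightarrow> 'a) set" where
  "brody_curves X A h =
     {f. holomorphic_curve X A f \<and> (\<forall>z. spherical_derivative A h f z \<le> 1)}"

definition compact_open_topology :: "'b topology \<Rightarrow> 'a topology \<Rightarrow> ('b \<Rightarrow> 'a) topology" where
  "compact_open_topology Y X = topology_generated_by
     {{f. continuous_map Y X f \<and> f ` K \<subseteq> U} | K U. compactin Y K \<and> openin X U}"

definition brody_space ::
  "'a topology \<Rightarrow> ('a, 'n::finite) chart set \<Rightarrow> (('a, 'n) chart \<Rightarrow> complex^'n \<Rightarrow> complex^'n^'n) \<Rightarrow>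
   (complex \<Rightarrow> 'a) topology" where
  "brody_space X A h =
     subtopology (compact_open_topology euclidean X) (brody_curves X A h)"

definition translation_invariant :: "(complex \<Rightarrow> 'a) set \<Rightarrow> bool" where
  "translation_invariant N \<longleftrightarrow> (\<forall>a. \<forall>f\<in>N. (\<lambda>z. f (z + a)) \<in> N)"


section \<open>Energy density\<close>

text \<open>Energies and densities are taken in the extended nonnegative reals, where every supremum
  exists and the supremum over the empty family is \<open>0\<close>.\<close>

definition energy ::
  "('a, 'n::finite) chart set \<Rightarrow> (('a, 'n) chart \<Rightarrow> complex^'n \<Rightarrow> complex^'n^'n) \<Rightarrow>
   (complex \<Rightarrow> 'a) \<Rightarrow> complex set \<Rightarrow> ennreal" where
  "energy A h f S = (\<integral>\<^sup>+z\<in>S. ennreal ((spherical_derivative A h f z)\<^sup>2) \<partial>lborel)"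

definition energy_density ::
  "('a, 'n::finite) chart set \<Rightarrow> (('a, 'n) chart \<Rightarrow> complex^'n \<Rightarrow> complex^'n^'n) \<Rightarrow>
   (complex \<Rightarrow> 'a) \<Rightarrow> ennreal" where
  "energy_density A h f =
     Lim at_top (\<lambda>R::real. ennreal (1 / (pi * R\<^sup>2)) * (SUP a. energy A h f (ball a R)))"

definition energy_density_set ::
  "('a, 'n::finite) chart set \<Rightarrow> (('a, 'n) chart \<Rightarrow> complex^'n \<Rightarrow> complex^'n^'n) \<Rightarrow>
   (complex \<Rightarrow> 'a) set \<Rightarrow> ennreal" where
  "energy_density_set A h N = (SUP f\<in>N. energy_density A h f)"

end

theory Submission
  imports Defs "HOL-Library.Diagonal_Subsequence"
begin

text \<open>
  Averaging the energies of the discs of radius \<open>r\<close> centred near a disc of radius \<open>R\<close> shows that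
  the normalised supremum \<open>s(R)\<close> satisfies \<open>s(R) \<le> (1 + r / R)\<^sup>2 * s(r)\<close>, so it converges to its
  infimum; this holds for \<open>N\<close> and for the translates of a single curve alike. It remains to find
  one curve in \<open>N\<close> whose density is that of \<open>N\<close>. Take curves that are almost optimal on discs of
  rapidly growing radii. By the same averaging, there are almost optimal discs of each smaller radius
  of the list within bounded distance of a common point, which a translation moves to the origin.
  Brody curves map discs of a fixed size into charts, where they are uniformly Lipschitz, so the
  translated curves subconverge, and the limit is almost optimal at every scale.
\<close>

text \<open>The obstacle is an exchange of supremum and limit: each radius may have its own almost
  optimal curve, which need not be good at any other scale. Two things must survive in the limit
  curve.

  The relative loss must stay bounded over arbitrarily long descents. Since
  \<open>rad k / rad (Suc k) = 1 / 2 ^ k\<close>, the factors from level \<open>k\<close> upward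
  multiply to at most \<open>exp (4 / 2 ^ k)\<close>. This is the reciprocal of
  \<open>loss k\<close>, and it tends to 1.

  The good discs must not escape to infinity. The distance from the common point to the disc of
  level \<open>k\<close> is at most \<open>reach k\<close>, whatever the level at which the descent
  began, so after the translation these discs stay in one bounded set.

  The descent sees only the functions |df|^2: measurable, with values in [0,1], forming a family
  that is closed under translation and sequentially compact for pointwise convergence. The geometry
  serves to establish these properties. Discs about the origin suffice in the theorem because a disc
  about \<open>a\<close> becomes one about 0 for a translate, which is again in
  \<open>N\<close>.\<close>

no_notation fps_nth (infixl "$" 75)

section \<open>Disc densities\<close>

lemma emeasure_lborel_disc:
  fixes a :: complex
  assumes "0 \<le> r"
  shows "emeasure lborel (ball a r) = ennreal (pi * r\<^sup>2)"
  using emeasure_ball[OF assms, of a] by (simp add: unit_ball_vol_2 DIM_complex)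

text \<open>Fubini over the pairs of points at distance less than \<open>r\<close>. A point
  \<open>z\<close> of the disc lies in \<open>ball b r\<close> for all \<open>b\<close> in
  \<open>ball z r\<close>, a set of area \<open>pi * r\<^sup>2\<close>, and these \<open>b\<close>
  belong to \<open>ball a (R + r)\<close>.\<close>

lemma disc_averaging:
  fixes e :: "complex \<Rightarrow> ennreal"
  assumes e [measurable]: "e \<in> borel_measurable borel" and "0 \<le> r"
  shows "(\<integral>\<^sup>+z\<in>ball a R. e z \<partial>lborel) * ennreal (pi * r\<^sup>2)
    \<le> (\<integral>\<^sup>+b\<in>ball a (R + r). (\<integral>\<^sup>+z\<in>ball b r. e z \<partial>lborel) \<partial>lborel)"
proof -
  have [measurable]: "ball (x :: complex) t \<in> sets borel" for x t
    by simp
  \<comment> \<open>With the moving ball written as an inequality, \<open>measurable\<close> can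
    treat the integrand as a function of the pair.\<close>
  have eq: "ball (x :: complex) t = {z. dist x z < t}" for x t
    by auto
  have "(\<integral>\<^sup>+z\<in>ball a R. e z \<partial>lborel) * ennreal (pi * r\<^sup>2)
      = (\<integral>\<^sup>+z. e z * indicator (ball a R) z * ennreal (pi * r\<^sup>2) \<partial>lborel)"
    by (intro nn_integral_multc[symmetric]) measurable
  also have "\<dots> = (\<integral>\<^sup>+z. e z * indicator (ball a R) z * (\<integral>\<^sup>+b. indicator (ball z r) b \<partial>lborel) \<partial>lborel)"
    using \<open>0 \<le> r\<close> by (simp add: emeasure_lborel_disc)
  also have "\<dots> = (\<integral>\<^sup>+z. \<integral>\<^sup>+b. e z * indicator (ball a R) z * indicator (ball z r) b \<partial>lborel \<partial>lborel)"
    by (simp add: nn_integral_cmult)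
  also have "\<dots> = (\<integral>\<^sup>+b. \<integral>\<^sup>+z. e z * indicator (ball a R) z * indicator (ball z r) b \<partial>lborel \<partial>lborel)"
    unfolding eq by (intro lborel_pair.Fubini'[symmetric]) measurable
  also have "\<dots> \<le> (\<integral>\<^sup>+b. (\<integral>\<^sup>+z. e z * indicator (ball b r) z * indicator (ball a (R + r)) b \<partial>lborel) \<partial>lborel)"
  proof (intro nn_integral_mono)
    fix b z :: complex
    have "dist a b \<le> dist a z + dist z b"
      by (rule dist_triangle)
    then show "e z * indicator (ball a R) z * indicator (ball z r) b
        \<le> e z * indicator (ball b r) z * indicator (ball a (R + r)) b"
      by (auto simp: indicator_def dist_commute)
  qed
  also have "\<dots> = (\<integral>\<^sup>+b\<in>ball a (R + r). (\<integral>\<^sup>+z\<in>ball b r. e z \<partial>lborel) \<partial>lborel)"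
    by (simp add: nn_integral_multc)
  finally show ?thesis .
qed

lemma disc_averaging_bound:
  fixes e :: "complex \<Rightarrow> ennreal"
  assumes "e \<in> borel_measurable borel" and "0 \<le> r" "0 \<le> R"
    and C: "\<And>b. dist a b < R + r \<Longrightarrow> (\<integral>\<^sup>+z\<in>ball b r. e z \<partial>lborel) \<le> C"
  shows "(\<integral>\<^sup>+z\<in>ball a R. e z \<partial>lborel) * ennreal (pi * r\<^sup>2) \<le> C * ennreal (pi * (R + r)\<^sup>2)"
proof -
  have "(\<integral>\<^sup>+b\<in>ball a (R + r). (\<integral>\<^sup>+z\<in>ball b r. e z \<partial>lborel) \<partial>lborel)
      \<le> (\<integral>\<^sup>+b. C * indicator (ball a (R + r)) b \<partial>lborel)"
    by (intro nn_integral_mono) (auto simp: C split: split_indicator)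
  also have "\<dots> = C * ennreal (pi * (R + r)\<^sup>2)"
    using assms(2,3) by (subst nn_integral_cmult_indicator) (auto simp: emeasure_lborel_disc)
  finally show ?thesis
    using disc_averaging[OF assms(1,2), of a R] by (rule order_trans[rotated])
qed

text \<open>The set argument lets one notion serve both for the functions |df|^2 of all curves in
  \<open>N\<close> and for the singleton of one curve, where the free centre \<open>a\<close> is
  that of the energy density.\<close>

definition sup_disc_density :: "(complex \<Rightarrow> real) set \<Rightarrow> real \<Rightarrow> ennreal" where
  "sup_disc_density F R =
     ennreal (1 / (pi * R\<^sup>2)) * (SUP e\<in>F. SUP a. (\<integral>\<^sup>+z\<in>ball a R. ennreal (e z) \<partial>lborel))"

text \<open>As an infimum, it bounds the value at every radius from below by definition.\<close>

definition lim_disc_density :: "(complex \<Rightarrow> real) set \<Rightarrow> ennreal" where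
  "lim_disc_density F = (INF R\<in>{0<..}. sup_disc_density F R)"

lemma sup_disc_density_upper:
  assumes "e \<in> F" "0 < R"
  shows "(\<integral>\<^sup>+z\<in>ball a R. ennreal (e z) \<partial>lborel) \<le> ennreal (pi * R\<^sup>2) * sup_disc_density F R"
proof -
  have "(\<integral>\<^sup>+z\<in>ball a R. ennreal (e z) \<partial>lborel) \<le> (SUP e\<in>F. SUP a. (\<integral>\<^sup>+z\<in>ball a R. ennreal (e z) \<partial>lborel))"
    using assms by (blast intro: SUP_upper2)
  also have "\<dots> = ennreal (pi * R\<^sup>2 * (1 / (pi * R\<^sup>2))) * \<dots>"
    using assms by simp
  also have "\<dots> = ennreal (pi * R\<^sup>2) * sup_disc_density F R"
    unfolding sup_disc_density_def by (subst ennreal_mult) (auto simp: mult.assoc)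
  finally show ?thesis .
qed

lemma sup_disc_density_least:
  assumes "0 < R"
    and C: "\<And>e a. e \<in> F \<Longrightarrow> (\<integral>\<^sup>+z\<in>ball a R. ennreal (e z) \<partial>lborel) \<le> ennreal (pi * R\<^sup>2) * C"
  shows "sup_disc_density F R \<le> C"
proof -
  have "sup_disc_density F R \<le> ennreal (1 / (pi * R\<^sup>2)) * (ennreal (pi * R\<^sup>2) * C)"
    unfolding sup_disc_density_def by (intro mult_left_mono SUP_least C) auto
  also have "\<dots> = ennreal (1 / (pi * R\<^sup>2) * (pi * R\<^sup>2)) * C"
    by (subst ennreal_mult) (auto simp: mult.assoc)
  also have "\<dots> = C"
    using assms by simp
  finally show ?thesis .
qed

lemma sup_disc_density_mono:
  assumes "F \<subseteq> G"
  shows "sup_disc_density F R \<le> sup_disc_density G R"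
  unfolding sup_disc_density_def by (intro mult_left_mono SUP_subset_mono assms) auto

lemma sup_disc_density_le_1:
  assumes "0 < R" and "\<And>e z. e \<in> F \<Longrightarrow> e z \<le> 1"
  shows "sup_disc_density F R \<le> 1"
proof (rule sup_disc_density_least[OF \<open>0 < R\<close>])
  fix e a assume "e \<in> F"
  have "(\<integral>\<^sup>+z\<in>ball a R. ennreal (e z) \<partial>lborel) \<le> (\<integral>\<^sup>+z. indicator (ball a R) z \<partial>lborel)"
    using assms(2)[OF \<open>e \<in> F\<close>] by (intro nn_integral_mono) (auto simp: indicator_def)
  also have "\<dots> = ennreal (pi * R\<^sup>2) * 1"
    using \<open>0 < R\<close> by (simp add: emeasure_lborel_disc)
  finally show "(\<integral>\<^sup>+z\<in>ball a R. ennreal (e z) \<partial>lborel) \<le> ennreal (pi * R\<^sup>2) * 1" .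
qed

text \<open>The factor is the ratio of the areas of the discs of radii \<open>R + r\<close> and
  \<open>R\<close>: averaging charges the smaller disc with the energy allowed on the larger
  one.\<close>

lemma sup_disc_density_quasi_mono:
  assumes "0 < r" "0 < R" and meas: "\<And>e. e \<in> F \<Longrightarrow> e \<in> borel_measurable borel"
  shows "sup_disc_density F R \<le> ennreal ((1 + r / R)\<^sup>2) * sup_disc_density F r"
proof (rule sup_disc_density_least[OF \<open>0 < R\<close>])
  fix e a assume "e \<in> F"
  let ?C = "ennreal (pi * r\<^sup>2) * sup_disc_density F r"
  let ?E = "\<integral>\<^sup>+z\<in>ball a R. ennreal (e z) \<partial>lborel"
  have "?E * ennreal (pi * r\<^sup>2) \<le> ?C * ennreal (pi * (R + r)\<^sup>2)"
    using assms meas[OF \<open>e \<in> F\<close>] sup_disc_density_upper[OF \<open>e \<in> F\<close> \<open>0 < r\<close>]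
    by (intro disc_averaging_bound) auto
  then have "ennreal (pi * r\<^sup>2) * ?E \<le> ennreal (pi * r\<^sup>2) * (sup_disc_density F r * ennreal (pi * (R + r)\<^sup>2))"
    by (simp add: ac_simps)
  then have "?E \<le> sup_disc_density F r * ennreal (pi * (R + r)\<^sup>2)"
    using \<open>0 < r\<close> by (subst (asm) ennreal_mult_le_mult_iff) auto
  also have "pi * (R + r)\<^sup>2 = (pi * R\<^sup>2) * (1 + r / R)\<^sup>2"
    using \<open>0 < R\<close> by (simp add: field_simps power2_eq_square)
  also have "ennreal \<dots> = ennreal (pi * R\<^sup>2) * ennreal ((1 + r / R)\<^sup>2)"
    by (simp add: ennreal_mult)
  finally show "?E \<le> ennreal (pi * R\<^sup>2) * (ennreal ((1 + r / R)\<^sup>2) * sup_disc_density F r)"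
    by (simp add: ac_simps)
qed

text \<open>Only the upper bound needs work: fix one radius \<open>r\<close> whose value is below
  \<open>y\<close> and let \<open>R\<close> grow, so that the factor of quasi-monotonicity tends to
  1.\<close>

lemma tendsto_lim_disc_density:
  assumes meas: "\<And>e. e \<in> F \<Longrightarrow> e \<in> borel_measurable borel"
    and le_1: "\<And>e z. e \<in> F \<Longrightarrow> e z \<le> 1"
  shows "(sup_disc_density F \<longlongrightarrow> lim_disc_density F) at_top"
proof (rule order_tendstoI)
  fix y assume "y < lim_disc_density F"
  then have "y < sup_disc_density F R" if "R > 0" for R
    using that unfolding lim_disc_density_def by (meson INF_lower greaterThan_iff order_less_le_trans)
  then show "\<forall>\<^sub>F R in at_top. y < sup_disc_density F R"
    using eventually_gt_at_top[of 0] by (rule eventually_mono[rotated])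
next
  fix y assume "lim_disc_density F < y"
  then obtain r where r: "r > 0" "sup_disc_density F r < y"
    unfolding lim_disc_density_def by (auto simp: INF_less_iff)
  \<comment> \<open>Multiplication by a constant is continuous in \<open>ennreal\<close> when the
    constant is finite.\<close>
  have "sup_disc_density F r \<le> 1"
    using r(1) le_1 by (rule sup_disc_density_le_1)
  have "((\<lambda>R. (1 + r / R)\<^sup>2) \<longlongrightarrow> (1 + 0)\<^sup>2) at_top"
    by (intro tendsto_intros real_tendsto_divide_at_top[OF tendsto_const] filterlim_ident)
  then have "((\<lambda>R. ennreal ((1 + r / R)\<^sup>2)) \<longlongrightarrow> ennreal 1) at_top"
    by (intro tendsto_ennrealI) simp
  then have "((\<lambda>R. ennreal ((1 + r / R)\<^sup>2) * sup_disc_density F r) \<longlongrightarrow> ennreal 1 * sup_disc_density F r) at_top"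
    unfolding mult.commute[of _ "sup_disc_density F r"]
    using \<open>sup_disc_density F r \<le> 1\<close> ennreal_one_less_top
    by (intro ennreal_tendsto_cmult) (rule order_le_less_trans)
  then have "\<forall>\<^sub>F R in at_top. ennreal ((1 + r / R)\<^sup>2) * sup_disc_density F r < y"
    using r by (intro order_tendstoD) auto
  with eventually_gt_at_top[of 0] show "\<forall>\<^sub>F R in at_top. sup_disc_density F R < y"
  proof eventually_elim
    case (elim R)
    then show ?case
      using sup_disc_density_quasi_mono[OF r(1) elim(1) meas] by (meson order_le_less_trans)
  qed
qed

section \<open>A single function of maximal density\<close>

text \<open>Radii growing so fast that the losses \<open>(1 + rad k / rad (Suc k))\<^sup>2\<close> in passing from a disc
  to a smaller one multiply up to a constant that is absorbed by \<open>loss\<close>.\<close>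

definition rad :: "nat \<Rightarrow> real" where
  "rad k = (\<Prod>j<k. 2 ^ j)"

definition loss :: "nat \<Rightarrow> real" where
  "loss k = exp (- 4 / 2 ^ k)"

text \<open>The total displacement possible in descending from level \<open>k\<close> to level 0,
  one \<open>heavy_step\<close> at a time.\<close>

definition reach :: "nat \<Rightarrow> real" where
  "reach k = (\<Sum>j<k. rad (Suc j) + rad j)"

lemma rad_Suc: "rad (Suc k) = 2 ^ k * rad k"
  by (simp add: rad_def)

lemma rad_pos: "0 < rad k"
  by (simp add: rad_def prod_pos)

text \<open>From \<open>1 + x \<le> exp x\<close>. The 4 in \<open>loss\<close> is the sum of all
  later exponents: 2 / 2^j over j \<ge> k adds up to 4 / 2^k.\<close>

lemma loss_Suc: "loss k * (1 + 1 / 2 ^ k)\<^sup>2 \<le> loss (Suc k)"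
proof -
  have "(1 + 1 / 2 ^ k)\<^sup>2 \<le> (exp (1 / 2 ^ k :: real))\<^sup>2"
    by (intro power_mono exp_ge_add_one_self) auto
  also have "\<dots> = exp (2 / 2 ^ k)"
    by (simp add: exp_of_nat_mult[symmetric] flip: exp_double)
  finally have "loss k * (1 + 1 / 2 ^ k)\<^sup>2 \<le> loss k * exp (2 / 2 ^ k)"
    by (rule mult_left_mono) (simp add: loss_def)
  also have "\<dots> = loss (Suc k)"
    unfolding loss_def exp_add[symmetric] by (simp add: field_simps)
  finally show ?thesis .
qed

lemma tendsto_loss: "loss \<longlonglongrightarrow> 1"
proof -
  have "(\<lambda>k. exp (- 4 / 2 ^ k) :: real) \<longlonglongrightarrow> exp 0"
    by real_asymp
  then show ?thesis
    by (simp add: loss_def[abs_def])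
qed

lemma filterlim_rad: "filterlim rad at_top sequentially"
proof -
  \<comment> \<open>The truncated subtraction makes the bound 1 for \<open>k = 0\<close> and
    \<open>k = 1\<close>, where \<open>rad\<close> is 1.\<close>
  have "rad k \<ge> 2 ^ (k - 1)" for k
  proof (induction k)
    case (Suc k)
    have "(2::real) ^ k * 1 \<le> 2 ^ k * rad k"
      using Suc order_trans[OF one_le_power[of 2 "k - 1"] Suc] by (intro mult_left_mono) auto
    then show ?case
      by (simp add: rad_Suc)
  qed (simp add: rad_def)
  moreover have "filterlim (\<lambda>k. 2 ^ (k - 1) :: real) at_top sequentially"
    by (subst filterlim_sequentially_Suc[symmetric]) (simp, real_asymp)
  ultimately show ?thesis
    by (intro filterlim_at_top_mono[of "\<lambda>k. 2 ^ (k - 1)" _ rad]) auto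
qed

text \<open>The inequality is strict so that its negation is a bound of the kind that
  \<open>disc_averaging_bound\<close> takes as hypothesis.\<close>

definition heavy :: "real \<Rightarrow> (complex \<Rightarrow> real) \<Rightarrow> nat \<Rightarrow> complex \<Rightarrow> bool" where
  "heavy q e k b \<longleftrightarrow>
     ennreal (q * loss k * (pi * (rad k)\<^sup>2)) < (\<integral>\<^sup>+z\<in>ball b (rad k). ennreal (e z) \<partial>lborel)"

text \<open>If all discs of level \<open>k\<close> near \<open>a\<close> were light, averaging would
  bound the energy of the disc of level \<open>Suc k\<close> by
  \<open>q * loss k * (1 + 1 / 2 ^ k)\<^sup>2\<close> times its area, which \<open>loss_Suc\<close>
  forbids.\<close>

lemma heavy_step:
  assumes meas: "e \<in> borel_measurable borel" and "0 \<le> q" and heavy: "heavy q e (Suc k) a"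
  obtains b where "dist a b < rad (Suc k) + rad k" "heavy q e k b"
proof -
  have "\<exists>b. dist a b < rad (Suc k) + rad k \<and> heavy q e k b"
  proof (rule ccontr)
    let ?r = "rad k" and ?R = "rad (Suc k)"
    let ?E = "\<integral>\<^sup>+z\<in>ball a ?R. ennreal (e z) \<partial>lborel"
    have [simp]: "0 < ?r" "0 < ?R"
      by (rule rad_pos)+
    have [simp]: "0 \<le> loss j" for j
      by (simp add: loss_def)
    assume "\<not> ?thesis"
    then have "?E * ennreal (pi * ?r\<^sup>2) \<le> ennreal (q * loss k * (pi * ?r\<^sup>2)) * ennreal (pi * (?R + ?r)\<^sup>2)"
      using meas by (intro disc_averaging_bound) (auto simp: heavy_def not_less less_imp_le[OF rad_pos] dest: leD)
    then have "ennreal (pi * ?r\<^sup>2) * ?E \<le> ennreal (pi * ?r\<^sup>2) * ennreal (q * loss k * (pi * (?R + ?r)\<^sup>2))"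
      using \<open>0 \<le> q\<close> by (simp add: ac_simps flip: ennreal_mult)
    then have "?E \<le> ennreal (q * loss k * (pi * (?R + ?r)\<^sup>2))"
      by (subst (asm) ennreal_mult_le_mult_iff) (auto simp: pi_neq_zero[symmetric] less_imp_neq[OF \<open>0 < ?r\<close>, symmetric])
    also have "q * loss k * (pi * (?R + ?r)\<^sup>2) = q * (loss k * (1 + 1 / 2 ^ k)\<^sup>2) * (pi * ?R\<^sup>2)"
      by (simp add: rad_Suc field_simps power2_eq_square)
    also have "\<dots> \<le> q * loss (Suc k) * (pi * ?R\<^sup>2)"
      using \<open>0 \<le> q\<close> by (intro mult_right_mono mult_left_mono loss_Suc) auto
    finally show False
      using heavy by (simp add: heavy_def leD ennreal_leI)
  qed
  then show thesis
    using that by blast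
qed

text \<open>The point \<open>p\<close> is the centre of the level 0 disc where the descent ends.
  Induction keeps \<open>p\<close> and adds a disc on top, placed by the conjunct
  \<open>dist a p \<le> reach n\<close>; hence the bounds \<open>reach k\<close> are independent of
  \<open>n\<close>.\<close>

lemma heavy_chain:
  assumes meas: "e \<in> borel_measurable borel" and "0 \<le> q"
  shows "heavy q e n a \<Longrightarrow> \<exists>p. dist a p \<le> reach n \<and> (\<forall>k\<le>n. \<exists>b. dist b p \<le> reach k \<and> heavy q e k b)"
proof (induction n arbitrary: a)
  case 0
  then show ?case
    by (intro exI[of _ a]) (auto simp: reach_def intro!: exI[of _ a])
next
  case (Suc n)
  obtain b where b: "dist a b < rad (Suc n) + rad n" "heavy q e n b"
    using heavy_step[OF meas \<open>0 \<le> q\<close> Suc.prems] .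
  obtain p where p: "dist b p \<le> reach n" "\<And>k. k \<le> n \<Longrightarrow> \<exists>b. dist b p \<le> reach k \<and> heavy q e k b"
    using Suc.IH[OF b(2)] by blast
  have "dist a p \<le> reach (Suc n)"
    using dist_triangle[of a p b] b(1) p(1) by (simp add: reach_def)
  then show ?case
    using p(2) Suc.prems by (intro exI[of _ p]) (auto simp: le_Suc_eq)
qed

lemma disc_integral_shift:
  fixes e :: "complex \<Rightarrow> ennreal"
  assumes [measurable]: "e \<in> borel_measurable borel"
  shows "(\<integral>\<^sup>+z\<in>ball a R. e (z + p) \<partial>lborel) = (\<integral>\<^sup>+z\<in>ball (a + p) R. e z \<partial>lborel)"
proof -
  have [measurable]: "ball (x :: complex) t \<in> sets borel" for x t
    by simp
  have "(\<integral>\<^sup>+z\<in>ball (a + p) R. e z \<partial>lborel)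
      = (\<integral>\<^sup>+z. e z * indicator (ball (a + p) R) z \<partial>distr lborel borel ((+) p))"
    by (simp add: lborel_distr_plus)
  also have "\<dots> = (\<integral>\<^sup>+z\<in>ball a R. e (z + p) \<partial>lborel)"
    by (subst nn_integral_distr)
       (auto intro!: nn_integral_cong simp: add.commute indicator_def dist_norm algebra_simps)
  finally show ?thesis
    by simp
qed

lemma heavy_shift:
  assumes "e \<in> borel_measurable borel"
  shows "heavy q (\<lambda>z. e (z + p)) k b \<longleftrightarrow> heavy q e k (b + p)"
  unfolding heavy_def using assms by (simp add: disc_integral_shift[of "\<lambda>z. ennreal (e z)"])

text \<open>The centre \<open>b\<close> varies with \<open>n\<close>, so convergence of the
  integrals over a fixed disc would not do. All the discs lie in one ball \<open>B\<close>, and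
  dominated convergence makes the L1 distance \<open>d n\<close> on \<open>B\<close> tend to 0, an
  error that serves every centre at once.\<close>

lemma sup_disc_density_limit:
  assumes meas: "\<And>n. e n \<in> borel_measurable borel" "g \<in> borel_measurable borel"
    and bounds: "\<And>n z. 0 \<le> e n z" "\<And>n z. e n z \<le> 1" "\<And>z. 0 \<le> g z" "\<And>z. g z \<le> 1"
    and lim: "\<And>z. (\<lambda>n. e n z) \<longlonglongrightarrow> g z"
    and "0 \<le> q"
    and heavy: "\<forall>\<^sub>F n in sequentially. \<exists>b. norm b \<le> D \<and> heavy q (e n) k b"
  shows "ennreal (q * loss k) \<le> sup_disc_density {g} (rad k)"
proof -
  note [measurable] = meas
  let ?r = "rad k"
  have [simp]: "0 < ?r"
    by (rule rad_pos)
  have [measurable]: "ball (x :: complex) t \<in> sets borel" for x t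
    by simp
  define B where "B = ball (0::complex) (D + ?r)"
  have [measurable]: "B \<in> sets borel"
    by (simp add: B_def)
  have finB: "(\<integral>\<^sup>+z. indicator B z \<partial>lborel) < \<infinity>"
    using emeasure_lborel_ball_finite[of 0 "D + ?r"] by (simp add: B_def)
  define d where "d n = (\<integral>\<^sup>+z. ennreal \<bar>e n z - g z\<bar> * indicator B z \<partial>lborel)" for n
  have "d \<longlonglongrightarrow> (\<integral>\<^sup>+z. 0 \<partial>(lborel :: complex measure))"
    unfolding d_def
  proof (rule nn_integral_dominated_convergence[where w = "indicator B", OF _ _ _ _ finB])
    have "\<bar>e n z - g z\<bar> \<le> 1" for n z
      using bounds(1,2)[of n z] bounds(3,4)[of z] by linarith
    then show "AE z in lborel. ennreal \<bar>e n z - g z\<bar> * indicator B z \<le> indicator B z" for n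
      by (auto split: split_indicator)
    have "(\<lambda>n. ennreal \<bar>e n z - g z\<bar> * indicator B z) \<longlonglongrightarrow> 0" for z
    proof -
      have "(\<lambda>n. ennreal \<bar>e n z - g z\<bar>) \<longlonglongrightarrow> ennreal \<bar>g z - g z\<bar>"
        by (intro tendsto_intros lim)
      then show ?thesis
        by (auto split: split_indicator)
    qed
    then show "AE z in lborel. (\<lambda>n. ennreal \<bar>e n z - g z\<bar> * indicator B z) \<longlonglongrightarrow> 0"
      by simp
  qed measurable
  then have "d \<longlonglongrightarrow> 0"
    by simp
  let ?S = "ennreal (pi * ?r\<^sup>2) * sup_disc_density {g} ?r"
  have "\<forall>\<^sub>F n in sequentially. ennreal (q * loss k * (pi * ?r\<^sup>2)) \<le> ?S + d n"
    using heavy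
  proof eventually_elim
    case (elim n)
    then obtain b where b: "norm b \<le> D" "heavy q (e n) k b"
      by blast
    have sub: "z \<in> B" if "z \<in> ball b ?r" for z
      using that b(1) norm_triangle_ineq[of b "z - b"] by (simp add: B_def dist_norm norm_minus_commute)
    have "ennreal (e n z) \<le> ennreal (g z) + ennreal \<bar>e n z - g z\<bar>" for z
      using ennreal_leI[of "e n z" "g z + \<bar>e n z - g z\<bar>"] bounds(3)[of z] by simp
    then have "(\<integral>\<^sup>+z\<in>ball b ?r. ennreal (e n z) \<partial>lborel)
        \<le> (\<integral>\<^sup>+z. ennreal (g z) * indicator (ball b ?r) z + ennreal \<bar>e n z - g z\<bar> * indicator B z \<partial>lborel)"
      using sub by (intro nn_integral_mono) (auto split: split_indicator)
    also have "\<dots> = (\<integral>\<^sup>+z\<in>ball b ?r. ennreal (g z) \<partial>lborel) + d n"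
      unfolding d_def by (intro nn_integral_add) measurable
    also have "\<dots> \<le> ?S + d n"
      by (intro add_right_mono sup_disc_density_upper) auto
    finally show ?case
      using b(2) unfolding heavy_def by (meson less_imp_le order_trans)
  qed
  moreover have "(\<lambda>n. ?S + d n) \<longlonglongrightarrow> ?S + 0"
    by (intro tendsto_intros \<open>d \<longlonglongrightarrow> 0\<close>)
  ultimately have "ennreal (q * loss k * (pi * ?r\<^sup>2)) \<le> ?S"
    by (intro tendsto_lowerbound[of "\<lambda>n. ?S + d n"]) auto
  then have "ennreal (pi * ?r\<^sup>2) * ennreal (q * loss k) \<le> ?S"
    using \<open>0 \<le> q\<close> by (simp add: loss_def mult.commute flip: ennreal_mult)
  then show ?thesis
    by (subst (asm) ennreal_mult_le_mult_iff) (auto simp: less_imp_neq[OF \<open>0 < ?r\<close>, symmetric])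
qed

theorem lim_disc_density_attained:
  assumes meas: "\<And>e. e \<in> F \<Longrightarrow> e \<in> borel_measurable borel"
    and bounds: "\<And>e z. e \<in> F \<Longrightarrow> 0 \<le> e z" "\<And>e z. e \<in> F \<Longrightarrow> e z \<le> 1"
    and shift: "\<And>e a. e \<in> F \<Longrightarrow> (\<lambda>z. e (z + a)) \<in> F"
    and seq_compact: "\<And>e :: nat \<Rightarrow> complex \<Rightarrow> real. (\<And>n. e n \<in> F) \<Longrightarrow>
          \<exists>g\<in>F. \<exists>s. strict_mono s \<and> (\<forall>z. (\<lambda>n. e (s n) z) \<longlonglongrightarrow> g z)"
  shows "lim_disc_density F = (SUP e\<in>F. lim_disc_density {e})"
proof (rule antisym)
  show "(SUP e\<in>F. lim_disc_density {e}) \<le> lim_disc_density F"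
    unfolding lim_disc_density_def by (intro SUP_least INF_mono) (auto intro: sup_disc_density_mono)
next
  show "lim_disc_density F \<le> (SUP e\<in>F. lim_disc_density {e})"
  \<comment> \<open>Density 0 is trivial and includes the empty family. Otherwise
    \<open>q > 0\<close>, which makes \<open>q * loss n < q\<close> strict.\<close>
  proof (cases "lim_disc_density F = 0")
    case False
    have le: "lim_disc_density F \<le> sup_disc_density F R" if "R > 0" for R
      using that unfolding lim_disc_density_def by (intro INF_lower) auto
    have "lim_disc_density F \<le> 1"
      using le[of 1] sup_disc_density_le_1[of 1 F] bounds(2) by (meson order_trans zero_less_one)
    then obtain q where q: "lim_disc_density F = ennreal q" "0 \<le> q"
      by (cases "lim_disc_density F") (auto simp: top_unique)
    with False have "0 < q"
      by (cases "q = 0") auto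
    \<comment> \<open>Without a heavy disc the value at radius \<open>rad n\<close> would be at most
      \<open>q * loss n\<close>, below the infimum \<open>q\<close>.\<close>
    have "\<exists>e\<in>F. \<exists>a. heavy q e n a" for n
    proof (rule ccontr)
      assume "\<not> ?thesis"
      then have "sup_disc_density F (rad n) \<le> ennreal (q * loss n)"
        using \<open>0 < q\<close>
        by (intro sup_disc_density_least rad_pos)
           (auto simp: heavy_def not_less loss_def mult.commute simp flip: ennreal_mult)
      also have "\<dots> < ennreal q"
        using \<open>0 < q\<close> by (intro ennreal_lessI) (auto simp: loss_def)
      finally show False
        using le[OF rad_pos, of n] q(1) by simp
    qed
    then obtain e a where e: "\<And>n. e n \<in> F" and a: "\<And>n. heavy q (e n) n (a n)"
      by metis
    have "\<exists>p. \<forall>k\<le>n. \<exists>b. dist b p \<le> reach k \<and> heavy q (e n) k b" for n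
      using heavy_chain[OF meas[OF e] \<open>0 \<le> q\<close> a] by blast
    then obtain p where p: "\<And>n k. k \<le> n \<Longrightarrow> \<exists>b. dist b (p n) \<le> reach k \<and> heavy q (e n) k b"
      by metis
    define e' where "e' n = (\<lambda>z. e n (z + p n))" for n
    have e': "e' n \<in> F" for n
      unfolding e'_def by (intro shift e)
    have heavy: "\<exists>b. norm b \<le> reach k \<and> heavy q (e' n) k b" if k: "k \<le> n" for k n
    proof -
      obtain b where "dist b (p n) \<le> reach k" "heavy q (e n) k b"
        using p[OF k] by blast
      then show ?thesis
        using meas[OF e[of n]] by (intro exI[of _ "b - p n"]) (simp add: e'_def heavy_shift dist_norm)
    qed
    obtain g s where g: "g \<in> F" and s: "strict_mono s" and lim: "\<And>z. (\<lambda>n. e' (s n) z) \<longlonglongrightarrow> g z"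
      using seq_compact[of e'] e' by blast
    have ge: "ennreal (q * loss k) \<le> sup_disc_density {g} (rad k)" for k
    proof (rule sup_disc_density_limit[where e = "\<lambda>n. e' (s n)" and D = "reach k"])
      show "\<forall>\<^sub>F n in sequentially. \<exists>b. norm b \<le> reach k \<and> heavy q (e' (s n)) k b"
        using eventually_ge_at_top[of k]
        by eventually_elim (meson heavy s seq_suble order_trans)
    qed (use meas bounds e' g lim \<open>0 \<le> q\<close> in auto)
    \<comment> \<open>The bounds hold only at the radii \<open>rad k\<close>. As the limit over all
      radii exists, it can be computed along these.\<close>
    have "(sup_disc_density {g} \<longlongrightarrow> lim_disc_density {g}) at_top"
      using meas bounds g by (intro tendsto_lim_disc_density) auto
    then have "(\<lambda>k. sup_disc_density {g} (rad k)) \<longlonglongrightarrow> lim_disc_density {g}"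
      by (rule filterlim_compose[OF _ filterlim_rad])
    moreover have "(\<lambda>k. ennreal (q * loss k)) \<longlonglongrightarrow> ennreal (q * 1)"
      by (intro tendsto_intros tendsto_loss)
    ultimately have "ennreal (q * 1) \<le> lim_disc_density {g}"
      using ge by (intro LIMSEQ_le[where X = "\<lambda>k. ennreal (q * loss k)"]) auto
    also have "\<dots> \<le> (SUP e\<in>F. lim_disc_density {e})"
      using g by (rule SUP_upper)
    finally show ?thesis
      using q(1) by simp
  qed simp
qed

section \<open>Curves in charts\<close>

lemma has_derivative_vec:
  fixes f :: "'a::real_normed_vector \<Rightarrow> 'b::real_normed_vector^'n"
  assumes "\<And>i. ((\<lambda>x. f x $ i) has_derivative (\<lambda>u. f' u $ i)) F"
  shows "(f has_derivative f') F"
proof -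
  have lin: "bounded_linear (axis i :: 'b \<Rightarrow> 'b^'n)" for i
  proof (rule bounded_linear_intro)
    show "norm (axis i x :: 'b^'n) \<le> norm x * 1" for x
      by (simp add: norm_vec_def L2_set_def axis_def if_distrib[of norm] if_distrib[of "\<lambda>x. x\<^sup>2"] cong: if_cong)
  qed (auto simp: axis_def vec_eq_iff)
  have repr: "x = (\<Sum>i\<in>UNIV. axis i (x $ i))" for x :: "'b^'n"
    by (simp add: vec_eq_iff axis_def if_distrib cong: if_cong)
  have "((\<lambda>x. \<Sum>i\<in>UNIV. axis i (f x $ i)) has_derivative (\<lambda>u. \<Sum>i\<in>UNIV. axis i (f' u $ i))) F"
    by (intro has_derivative_sum bounded_linear.has_derivative[OF lin] assms)
  then show ?thesis
    unfolding repr[symmetric] .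
qed

text \<open>Holomorphic components make the real derivative complex linear, hence multiplication by
  a single vector.\<close>

lemma has_derivative_vec_deriv:
  fixes \<phi> :: "complex \<Rightarrow> complex^'n"
  assumes "\<And>i. (\<lambda>w. \<phi> w $ i) field_differentiable at z"
  shows "(\<phi> has_derivative (\<lambda>u. u *s (\<chi> i. deriv (\<lambda>w. \<phi> w $ i) z))) (at z)"
proof (rule has_derivative_vec)
  fix i
  have "((\<lambda>w. \<phi> w $ i) has_field_derivative deriv (\<lambda>w. \<phi> w $ i) z) (at z)"
    using assms by (simp add: field_differentiable_derivI)
  then show "((\<lambda>w. \<phi> w $ i) has_derivative (\<lambda>u. (u *s (\<chi> i. deriv (\<lambda>w. \<phi> w $ i) z)) $ i)) (at z)"
    by (simp add: has_field_derivative_def mult.commute[of _ "deriv (\<lambda>w. \<phi> w $ i) z"])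
qed

lemma norm_scalar_vec: "norm (u *s w) = cmod u * norm (w :: complex^'n)"
  by (simp add: norm_vec_def L2_set_def norm_mult power_mult_distrib real_sqrt_mult
      flip: sum_distrib_left)

section \<open>Hermitian forms and the speed of a curve in a chart\<close>

lemma hermitian_form_scale:
  "hermitian_form H (a *s u) (b *s v) = a * cnj b * hermitian_form H u v"
  by (simp add: hermitian_form_def sum_distrib_left ac_simps)

lemma hermitian_form_zero [simp]: "hermitian_form H 0 v = 0"
  by (simp add: hermitian_form_def)

lemma hermitian_form_diagonal_real:
  fixes H :: "complex^'n^'n"
  assumes "\<And>i j. H $ j $ i = cnj (H $ i $ j)"
  shows "Im (hermitian_form H v v) = 0"
proof -
  have "cnj (hermitian_form H v v) = (\<Sum>i\<in>UNIV. \<Sum>j\<in>UNIV. H $ j $ i * v $ j * cnj (v $ i))"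
    by (simp add: hermitian_form_def assms[symmetric] ac_simps)
  also have "\<dots> = hermitian_form H v v"
    unfolding hermitian_form_def by (rule sum.swap)
  finally show ?thesis
    by (simp add: complex_eq_iff)
qed

lemma tendsto_hermitian_form:
  assumes "\<And>i j. ((\<lambda>x. H x $ i $ j) \<longlongrightarrow> H0 $ i $ j) F" "(u \<longlongrightarrow> u0) F" "(v \<longlongrightarrow> v0) F"
  shows "((\<lambda>x. hermitian_form (H x) (u x) (v x)) \<longlongrightarrow> hermitian_form H0 u0 v0) F"
  unfolding hermitian_form_def by (intro tendsto_intros assms)

text \<open>Built from \<open>deriv\<close> componentwise, so that continuity and limits of the
  velocity come from one-variable complex analysis.\<close>

definition velocity :: "('a, 'n::finite) chart \<Rightarrow> (complex \<Rightarrow> 'a) \<Rightarrow> complex \<Rightarrow> complex^'n" where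
  "velocity c f z = (\<chi> i. deriv (\<lambda>z. snd c (f z) $ i) z)"

text \<open>This is |df|^2 computed in the chart \<open>c\<close>. The form is real on the diagonal,
  so \<open>Re\<close> discards nothing.\<close>

definition chart_speed_sq ::
  "(('a, 'n::finite) chart \<Rightarrow> complex^'n \<Rightarrow> complex^'n^'n) \<Rightarrow> ('a, 'n) chart \<Rightarrow>
   (complex \<Rightarrow> 'a) \<Rightarrow> complex \<Rightarrow> real" where
  "chart_speed_sq h c f z =
     Re (hermitian_form (h c (snd c (f z))) (velocity c f z) (velocity c f z))"

lemma velocity_shift: "velocity c (\<lambda>z. f (z + a)) z = velocity c f (z + a)"
  by (simp add: velocity_def deriv_def DERIV_shift[where f = "\<lambda>z. snd c (f z) $ i" for i])

lemma chart_speed_sq_shift: "chart_speed_sq h c (\<lambda>z. f (z + a)) z = chart_speed_sq h c f (z + a)"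
  by (simp add: chart_speed_sq_def velocity_shift)

section \<open>Topology of charts and changes of coordinates\<close>

context complex_manifold
begin

lemma chart_props:
  assumes "c \<in> A"
  shows openin_chart: "openin X (fst c)"
    and open_chart_image: "open (snd c ` fst c)"
    and homeomorphic_chart:
      "homeomorphic_map (subtopology X (fst c)) (top_of_set (snd c ` fst c)) (snd c)"
  using charts[OF assms] by (auto simp: is_chart_def split: prod.splits)

lemma topspace_chart: "c \<in> A \<Longrightarrow> topspace X \<inter> fst c = fst c"
  using openin_subset[OF openin_chart] by blast

lemma inj_on_chart: "c \<in> A \<Longrightarrow> inj_on (snd c) (fst c)"
  using homeomorphic_imp_injective_map[OF homeomorphic_chart] by (simp add: topspace_chart)

lemma open_chart_image_subset:
  assumes "c \<in> A" "openin X U"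
  shows "open (snd c ` (U \<inter> fst c))"
proof -
  have "openin (subtopology X (fst c)) (U \<inter> fst c)"
    using assms by (auto simp: openin_subtopology)
  then have "openin (top_of_set (snd c ` fst c)) (snd c ` (U \<inter> fst c))"
    using homeomorphic_imp_open_map[OF homeomorphic_chart[OF \<open>c \<in> A\<close>]] by (simp add: open_map_def)
  then show ?thesis
    using open_chart_image[OF \<open>c \<in> A\<close>] by (simp add: openin_open_eq)
qed

lemma openin_chart_vimage:
  assumes "c \<in> A" "open V"
  shows "openin X {x \<in> fst c. snd c x \<in> V}"
proof -
  have "openin (subtopology X (fst c)) {x \<in> topspace (subtopology X (fst c)). snd c x \<in> V}"
    using homeomorphic_imp_continuous_map[OF homeomorphic_chart[OF \<open>c \<in> A\<close>]] \<open>open V\<close>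
    by (intro openin_continuous_map_preimage[where Y = euclidean])
       (auto simp: continuous_map_in_subtopology)
  then show ?thesis
    using openin_trans_full[OF _ openin_chart[OF \<open>c \<in> A\<close>]] by (simp add: topspace_chart[OF \<open>c \<in> A\<close>])
qed

lemma continuous_map_chart_inverse:
  assumes "c \<in> A"
  shows "continuous_map (top_of_set (snd c ` fst c)) X (the_inv_into (fst c) (snd c))"
proof -
  obtain \<psi> where "homeomorphic_maps (subtopology X (fst c)) (top_of_set (snd c ` fst c)) (snd c) \<psi>"
    using homeomorphic_chart[OF assms] by (auto simp: homeomorphic_map_maps)
  then have \<psi>: "continuous_map (top_of_set (snd c ` fst c)) X \<psi>" "\<And>x. x \<in> fst c \<Longrightarrow> \<psi> (snd c x) = x"
    using topspace_chart[OF assms] by (auto simp: homeomorphic_maps_def continuous_map_in_subtopology)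
  show ?thesis
    by (rule continuous_map_eq[OF \<psi>(1)]) (auto simp: \<psi>(2) the_inv_into_f_f[OF inj_on_chart[OF assms]])
qed

text \<open>The set is the image of \<open>K\<close> under the inverse chart. Being compact in
  \<open>X\<close> itself, it is closed in \<open>X\<close>, which prevents a curve from leaving the
  chart through a limit point.\<close>

lemma compactin_chart_vimage:
  assumes "c \<in> A" "compact K" "K \<subseteq> snd c ` fst c"
  shows "compactin X {x \<in> fst c. snd c x \<in> K}"
proof -
  have "compactin X (the_inv_into (fst c) (snd c) ` K)"
    using assms by (intro image_compactin[OF _ continuous_map_chart_inverse[OF \<open>c \<in> A\<close>]])
      (simp add: compactin_subtopology)
  also have "the_inv_into (fst c) (snd c) ` K = {x \<in> fst c. snd c x \<in> K}"
    using assms(3) inj_on_chart[OF \<open>c \<in> A\<close>]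
    by (auto simp: the_inv_into_f_f image_iff subset_iff) (metis the_inv_into_f_f)
  finally show ?thesis .
qed

lemma curve_in_manifold: "holomorphic_curve X A f \<Longrightarrow> f z \<in> topspace X"
  by (auto simp: holomorphic_curve_def continuous_map_def)

lemma curve_in_chart: "holomorphic_curve X A f \<Longrightarrow> \<exists>c\<in>A. f z \<in> fst c"
  using curve_in_manifold[of f z] cover by auto

lemma open_curve_vimage:
  assumes "holomorphic_curve X A f" "openin X U"
  shows "open (f -` U)"
  using openin_continuous_map_preimage[of euclidean X f U] assms
  by (simp add: holomorphic_curve_def vimage_def)

lemma holomorphic_curve_component:
  "holomorphic_curve X A f \<Longrightarrow> c \<in> A \<Longrightarrow> (\<lambda>z. snd c (f z) $ i) holomorphic_on (f -` fst c)"
  by (simp add: holomorphic_curve_def)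

lemma curve_has_derivative:
  assumes "holomorphic_curve X A f" "c \<in> A" "f z \<in> fst c"
  shows "((\<lambda>z. snd c (f z)) has_derivative (\<lambda>u. u *s velocity c f z)) (at z)"
  unfolding velocity_def
proof (rule has_derivative_vec_deriv)
  fix i
  show "(\<lambda>z. snd c (f z) $ i) field_differentiable at z"
    using holomorphic_curve_component[OF assms(1,2)] open_curve_vimage[OF assms(1) openin_chart[OF assms(2)]] assms(3)
    by (intro holomorphic_on_imp_differentiable_at) auto
qed

text \<open>Continuity of \<open>f\<close> is the assumption because the lemma also serves to prove
  that a limit map is holomorphic.\<close>

lemma eventually_transition:
  assumes "continuous_map euclidean X f" "c \<in> A" "d \<in> A" "f z \<in> fst c \<inter> fst d"
  shows "\<forall>\<^sub>F w in nhds z. transition c d (snd c (f w)) = snd d (f w)"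
proof -
  have "openin X (fst c \<inter> fst d)"
    using assms(2,3) by (intro openin_Int openin_chart)
  then have "open (f -` (fst c \<inter> fst d))"
    using openin_continuous_map_preimage[OF assms(1), of "fst c \<inter> fst d"] by (simp add: vimage_def)
  then have "\<forall>\<^sub>F w in nhds z. w \<in> f -` (fst c \<inter> fst d)"
    using assms(4) by (intro eventually_nhds_in_open) auto
  then show ?thesis
    by eventually_elim (simp add: transition_def the_inv_into_f_f[OF inj_on_chart[OF \<open>c \<in> A\<close>]])
qed

lemma transition_has_derivative:
  assumes "c \<in> A" "d \<in> A" "x \<in> fst c \<inter> fst d"
  obtains D where "(transition c d has_derivative D) (at (snd c x))" "\<And>a v. D (a *s v) = a *s D v"
  using compatible[OF assms(1,2)] assms(3) unfolding holomorphic_map_on_def by blast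

text \<open>The chain rule and uniqueness of the derivative, evaluated at the tangent vector
  \<open>u = 1\<close>.\<close>

lemma velocity_transition:
  assumes "holomorphic_curve X A f" "c \<in> A" "d \<in> A" "f z \<in> fst c \<inter> fst d"
  shows "velocity d f z = frechet_derivative (transition c d) (at (snd c (f z))) (velocity c f z)"
proof -
  obtain D where D: "(transition c d has_derivative D) (at (snd c (f z)))"
    by (rule transition_has_derivative[OF assms(2-4)])
  have "((\<lambda>w. transition c d (snd c (f w))) has_derivative (\<lambda>u. D (u *s velocity c f z))) (at z)"
    using assms by (intro has_derivative_compose[OF curve_has_derivative[of f c z] D]) auto
  moreover have "\<forall>\<^sub>F w in at z. transition c d (snd c (f w)) = snd d (f w)"
    and "transition c d (snd c (f z)) = snd d (f z)"
    using eventually_transition[of f c d z] assms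
    by (auto simp: eventually_nhds_conv_at holomorphic_curve_def)
  ultimately have "((\<lambda>w. snd d (f w)) has_derivative (\<lambda>u. D (u *s velocity c f z))) (at z)"
    by (rule has_derivative_transform_eventually) auto
  then have "(\<lambda>u. D (u *s velocity c f z)) = (\<lambda>u. u *s velocity d f z)"
    using assms by (intro has_derivative_unique[OF _ curve_has_derivative]) auto
  then have "D (1 *s velocity c f z) = 1 *s velocity d f z"
    by meson
  then show ?thesis
    using frechet_derivative_at[OF D] by simp
qed

end

section \<open>The spherical derivative in coordinates\<close>

context hermitian_manifold
begin

lemma metric_continuous_on: "c \<in> A \<Longrightarrow> continuous_on (snd c ` fst c) (\<lambda>p. h c p $ i $ j)"
  using smooth[of c i j] unfolding C_infinity_on_def by (metis C_k_on.simps(1))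

lemma metric_nonneg:
  assumes "c \<in> A" "x \<in> fst c"
  shows "0 \<le> Re (hermitian_form (h c (snd c x)) v v)"
  using positive[OF assms(1), of "snd c x" v] assms(2) by (cases "v = 0") auto

lemma chart_speed_sq_transition:
  assumes "holomorphic_curve X A f" "c \<in> A" "d \<in> A" "f z \<in> fst c \<inter> fst d"
  shows "chart_speed_sq h c f z = chart_speed_sq h d f z"
  unfolding chart_speed_sq_def velocity_transition[OF assms]
  by (subst coordinate_change[OF assms(2-4)]) simp

text \<open>The derivative multiplies the velocity by \<open>u\<close> and \<open>v\<close>, so the
  form is \<open>u * cnj v\<close> times the real number |df|^2, and \<open>- Im (u * cnj v)\<close>
  is \<open>dx_wedge_dy u v\<close>.\<close>

lemma pullback_kaehler_eq:
  assumes "holomorphic_curve X A f" "c \<in> A" "f z \<in> fst c"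
  shows "pullback_kaehler h c f z u v = chart_speed_sq h c f z * dx_wedge_dy u v"
proof -
  have D: "frechet_derivative (snd c \<circ> f) (at z) = (\<lambda>u. u *s velocity c f z)"
    using frechet_derivative_at[OF curve_has_derivative[OF assms]] by (simp add: o_def)
  have "Im (hermitian_form (h c (snd c (f z))) (velocity c f z) (velocity c f z)) = 0"
    using assms by (intro hermitian_form_diagonal_real hermitian) auto
  then show ?thesis
    by (simp add: pullback_kaehler_def kaehler_form_def D hermitian_form_scale chart_speed_sq_def
        dx_wedge_dy_def algebra_simps)
qed

lemma chart_speed_sq_nonneg: "c \<in> A \<Longrightarrow> f z \<in> fst c \<Longrightarrow> 0 \<le> chart_speed_sq h c f z"
  unfolding chart_speed_sq_def by (intro metric_nonneg)

text \<open>For the \<open>THE\<close>, existence is independence of the chart; uniqueness follows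
  from the pair \<open>1\<close>, \<open>\<i>\<close>, on which \<open>dx_wedge_dy\<close> is
  1.\<close>

lemma spherical_derivative_eq:
  assumes "holomorphic_curve X A f" "c \<in> A" "f z \<in> fst c"
  shows "spherical_derivative A h f z = sqrt (chart_speed_sq h c f z)" (is "_ = ?r")
  unfolding spherical_derivative_def
proof (rule the_equality)
  have nonneg: "0 \<le> chart_speed_sq h c f z"
    using assms by (intro chart_speed_sq_nonneg)
  have "pullback_kaehler h d f z u v = ?r\<^sup>2 * dx_wedge_dy u v" if "d \<in> A" "f z \<in> fst d" for d u v
    using pullback_kaehler_eq[OF assms(1) that] chart_speed_sq_transition[of f c d z] assms that nonneg
    by simp
  then show "0 \<le> ?r \<and> (\<forall>d\<in>A. f z \<in> fst d \<longrightarrow>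
      (\<forall>u v. pullback_kaehler h d f z u v = ?r\<^sup>2 * dx_wedge_dy u v))"
    using nonneg by simp
next
  fix r
  assume r: "0 \<le> r \<and> (\<forall>d\<in>A. f z \<in> fst d \<longrightarrow>
      (\<forall>u v. pullback_kaehler h d f z u v = r\<^sup>2 * dx_wedge_dy u v))"
  then have "pullback_kaehler h c f z 1 \<i> = r\<^sup>2 * dx_wedge_dy 1 \<i>"
    using assms by blast
  then have "r\<^sup>2 = chart_speed_sq h c f z"
    using assms by (simp add: pullback_kaehler_eq dx_wedge_dy_def)
  then show "r = ?r"
    using r by (simp add: real_sqrt_unique)
qed

lemma spherical_derivative_sq:
  assumes "holomorphic_curve X A f" "c \<in> A" "f z \<in> fst c"
  shows "(spherical_derivative A h f z)\<^sup>2 = chart_speed_sq h c f z"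
  using assms by (simp add: spherical_derivative_eq chart_speed_sq_nonneg)

text \<open>Curve and point both vary, which covers the continuity of |df|^2 along one curve as well
  as the convergence for a sequence of curves at one point.\<close>

lemma tendsto_chart_speed_sq:
  assumes "c \<in> A" "x \<in> fst c" "\<forall>\<^sub>F n in G. f n (w n) \<in> fst c"
    and "((\<lambda>n. snd c (f n (w n))) \<longlongrightarrow> snd c x) G" "((\<lambda>n. velocity c (f n) (w n)) \<longlongrightarrow> v) G"
  shows "((\<lambda>n. chart_speed_sq h c (f n) (w n)) \<longlongrightarrow> Re (hermitian_form (h c (snd c x)) v v)) G"
  unfolding chart_speed_sq_def
proof (intro tendsto_Re tendsto_hermitian_form assms)
  show "((\<lambda>n. h c (snd c (f n (w n))) $ i $ j) \<longlongrightarrow> h c (snd c x) $ i $ j) G" for i j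
    using assms
    by (intro continuous_on_tendsto_compose[OF metric_continuous_on[OF \<open>c \<in> A\<close>]])
       (auto elim: eventually_mono)
qed

lemma continuous_spherical_derivative_sq:
  assumes f: "holomorphic_curve X A f"
  shows "continuous_on UNIV (\<lambda>z. (spherical_derivative A h f z)\<^sup>2)"
  unfolding continuous_on_eq_continuous_at[OF open_UNIV]
proof
  fix z
  obtain c where c: "c \<in> A" "f z \<in> fst c"
    using curve_in_chart[OF f] by blast
  have op: "open (f -` fst c)"
    using f openin_chart[OF \<open>c \<in> A\<close>] by (rule open_curve_vimage)
  then have ev: "\<forall>\<^sub>F w in nhds z. f w \<in> fst c"
    using c(2) eventually_nhds_in_open[of "f -` fst c" z] by auto
  have "isCont (velocity c f) z"
    unfolding velocity_def isCont_def
  proof (intro tendsto_vec_lambda)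
    fix i
    have "(deriv (\<lambda>z. snd c (f z) $ i)) holomorphic_on (f -` fst c)"
      using holomorphic_curve_component[OF f c(1)] op by (rule holomorphic_deriv)
    then have "isCont (deriv (\<lambda>z. snd c (f z) $ i)) z"
      using op c(2) by (auto dest!: holomorphic_on_imp_continuous_on simp: continuous_on_eq_continuous_at)
    then show "deriv (\<lambda>z. snd c (f z) $ i) \<midarrow>z\<rightarrow> deriv (\<lambda>z. snd c (f z) $ i) z"
      by (simp add: isCont_def)
  qed
  moreover have "isCont (\<lambda>z. snd c (f z)) z"
    using curve_has_derivative[OF f c] by (rule has_derivative_continuous)
  ultimately have "((\<lambda>w. chart_speed_sq h c f w) \<longlongrightarrow> chart_speed_sq h c f z) (at z)"
    using ev by (subst (2) chart_speed_sq_def, intro tendsto_chart_speed_sq c)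
      (auto simp: isCont_def eventually_nhds_conv_at)
  then have "isCont (chart_speed_sq h c f) z"
    by (simp add: isCont_def)
  moreover have "\<forall>\<^sub>F w in nhds z. (spherical_derivative A h f w)\<^sup>2 = chart_speed_sq h c f w"
    using ev by eventually_elim (rule spherical_derivative_sq[OF f c(1)])
  ultimately show "isCont (\<lambda>z. (spherical_derivative A h f z)\<^sup>2) z"
    by (subst isCont_cong)
qed

end

section \<open>Uniform charts for Brody curves\<close>

context hermitian_manifold
begin

text \<open>The form has a positive minimum on the compact product of \<open>K\<close> with the unit
  sphere; homogeneity of degree 2 does the rest. For empty \<open>K\<close> any \<open>m\<close>
  will do.\<close>

lemma metric_lower_bound:
  assumes c: "c \<in> A" and K: "compact K" "K \<subseteq> snd c ` fst c"
  obtains m where "m > 0" "\<And>p v. p \<in> K \<Longrightarrow> m * (norm v)\<^sup>2 \<le> Re (hermitian_form (h c p) v v)"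
proof -
  define Q where "Q = (\<lambda>(p, v). Re (hermitian_form (h c p) v v))"
  let ?S = "K \<times> sphere (0 :: complex^'n) 1"
  have "\<exists>m>0. \<forall>y\<in>?S. m \<le> Q y"
  proof (cases "?S = {}")
    case False
    have "continuous_on K (\<lambda>p. h c p $ i $ j)" for i j
      using metric_continuous_on[OF c] K(2) by (rule continuous_on_subset)
    then have "continuous_on ?S (\<lambda>y. h c (fst y) $ i $ j)" for i j
      by (intro continuous_on_compose2[of K "\<lambda>p. h c p $ i $ j" _ fst] continuous_on_fst) (auto intro: continuous_on_id)
    then have "continuous_on ?S Q"
      unfolding Q_def case_prod_beta continuous_on_def
      by (intro ballI tendsto_Re tendsto_hermitian_form tendsto_snd tendsto_ident_at) blast
    moreover have "compact ?S"
      using K by (intro compact_Times) auto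
    ultimately obtain y where y: "y \<in> ?S" "\<And>y'. y' \<in> ?S \<Longrightarrow> Q y \<le> Q y'"
      using continuous_attains_inf[of ?S Q] False by blast
    moreover have "0 < Q y"
    proof -
      have "snd y \<noteq> 0"
        using y(1) by auto
      then show ?thesis
        using y(1) K(2) by (auto simp: Q_def case_prod_beta intro!: positive[OF c])
    qed
    ultimately show ?thesis
      by blast
  qed (auto intro: exI[of _ 1])
  then obtain m where m: "m > 0" "\<And>p v. p \<in> K \<Longrightarrow> norm v = 1 \<Longrightarrow> m \<le> Re (hermitian_form (h c p) v v)"
    by (auto simp: Q_def)
  have "m * (norm v)\<^sup>2 \<le> Re (hermitian_form (h c p) v v)" if "p \<in> K" for p v
  proof (cases "v = 0")
    case False
    define t where "t = complex_of_real (norm v)"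
    define u where "u = inverse t *s v"
    have "t \<noteq> 0"
      using False by (simp add: t_def)
    have v: "v = t *s u"
      using \<open>t \<noteq> 0\<close> by (simp add: u_def vector_scalar_mult_def vec_eq_iff)
    have "norm u = 1"
      using False by (simp add: u_def t_def norm_scalar_vec norm_inverse)
    have "t * cnj t = complex_of_real ((norm v)\<^sup>2)"
      by (simp add: t_def power2_eq_square)
    then have "Re (hermitian_form (h c p) v v) = (norm v)\<^sup>2 * Re (hermitian_form (h c p) u u)"
      by (subst (1 2) v) (simp add: hermitian_form_scale)
    also have "\<dots> \<ge> (norm v)\<^sup>2 * m"
      using m(2)[OF that \<open>norm u = 1\<close>] by (rule mult_left_mono) simp
    finally show ?thesis
      by (simp add: mult.commute)
  qed simp
  with m(1) show thesis
    using that by blast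
qed

text \<open>Speed at most 1 in the metric becomes a Euclidean bound, by comparing the two norms over
  \<open>K\<close>. That \<open>L\<close> is the same for all Brody curves is the source of
  equicontinuity.\<close>

lemma brody_velocity_bound:
  assumes c: "c \<in> A" and K: "compact K" "K \<subseteq> snd c ` fst c"
  obtains L where "L > 0"
    "\<And>f z. f \<in> brody_curves X A h \<Longrightarrow> f z \<in> fst c \<Longrightarrow> snd c (f z) \<in> K \<Longrightarrow> norm (velocity c f z) \<le> L"
proof -
  obtain m where m: "m > 0" "\<And>p v. p \<in> K \<Longrightarrow> m * (norm v)\<^sup>2 \<le> Re (hermitian_form (h c p) v v)"
    using metric_lower_bound[OF assms] by blast
  show thesis
  proof (rule that[of "sqrt (1 / m)"])
    fix f z assume f: "f \<in> brody_curves X A h" "f z \<in> fst c" "snd c (f z) \<in> K"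
    then have hol: "holomorphic_curve X A f" and le: "spherical_derivative A h f z \<le> 1"
      by (auto simp: brody_curves_def)
    have "chart_speed_sq h c f z \<le> 1"
      using le by (simp add: spherical_derivative_eq[OF hol c f(2)])
    then have "m * (norm (velocity c f z))\<^sup>2 \<le> 1"
      using m(2)[OF f(3), of "velocity c f z"]
      by (simp add: chart_speed_sq_def)
    then have "(norm (velocity c f z))\<^sup>2 \<le> 1 / m"
      using m(1) by (simp add: field_simps)
    then show "norm (velocity c f z) \<le> sqrt (1 / m)"
      by (rule real_le_rsqrt)
  qed (use m(1) in simp)
qed

lemma curve_lipschitz_on_convex:
  assumes f: "holomorphic_curve X A f" and c: "c \<in> A" and S: "convex S" "\<And>z. z \<in> S \<Longrightarrow> f z \<in> fst c"
    and L: "\<And>z. z \<in> S \<Longrightarrow> norm (velocity c f z) \<le> L"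
    and "x \<in> S" "y \<in> S"
  shows "norm (snd c (f x) - snd c (f y)) \<le> L * norm (x - y)"
proof (rule differentiable_bound[OF S(1) _ _ \<open>x \<in> S\<close> \<open>y \<in> S\<close>])
  fix z assume z: "z \<in> S"
  show "((\<lambda>z. snd c (f z)) has_derivative (\<lambda>u. u *s velocity c f z)) (at z within S)"
    using curve_has_derivative[OF f c S(2)[OF z]] by (rule has_derivative_at_withinI)
  show "onorm (\<lambda>u. u *s velocity c f z) \<le> L"
  proof (rule onorm_le)
    show "norm (u *s velocity c f z) \<le> L * norm u" for u
      using mult_right_mono[OF L[OF z], of "cmod u"] by (simp add: norm_scalar_vec mult.commute)
  qed
qed

text \<open>A curve that starts in the half-size ball cannot reach the boundary of the big one in time
  less than \<open>r / L\<close>: at the first exit time it would still be in a closed ball of the chart.\<close>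

lemma brody_trapped:
  assumes c: "c \<in> A" and K: "cball p (2 * r) \<subseteq> snd c ` fst c"
    and L: "L > 0" "\<And>z. f z \<in> fst c \<Longrightarrow> snd c (f z) \<in> cball p (2 * r) \<Longrightarrow> norm (velocity c f z) \<le> L"
    and f: "holomorphic_curve X A f"
    and z0: "f z0 \<in> fst c" "snd c (f z0) \<in> ball p r"
    and z: "z \<in> ball z0 (r / L)"
  shows "f z \<in> fst c \<and> snd c (f z) \<in> ball p (2 * r)"
proof (rule ccontr)
  assume out: "\<not> ?thesis"
  define W where "W = {x \<in> fst c. snd c x \<in> ball p (2 * r)}"
  define T where "T = f -` W"
  have "open T"
    unfolding T_def W_def by (intro open_curve_vimage[OF f] openin_chart_vimage[OF c] open_ball)
  define \<gamma> where "\<gamma> t = z0 + complex_of_real t * (z - z0)" for t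
  have cont: "continuous_on UNIV \<gamma>"
    unfolding \<gamma>_def by (intro continuous_intros)
  define S where "S = {0..1} \<inter> \<gamma> -` (- T)"
  have "closed (\<gamma> -` (- T))"
    using \<open>open T\<close> cont by (intro closed_vimage) (auto simp: closed_def)
  then have "compact S"
    unfolding S_def by (intro compact_Int_closed) auto
  have "1 \<in> S"
    using out by (auto simp: S_def \<gamma>_def T_def W_def)
  \<comment> \<open>The first exit time of the segment from \<open>T\<close>.\<close>
  then obtain s where s: "s \<in> S" "\<And>t. t \<in> S \<Longrightarrow> s \<le> t"
    using compact_attains_inf[OF \<open>compact S\<close>] by blast
  have "r > 0"
    using z0(2) by (smt (verit) mem_ball zero_le_dist)
  have "z0 \<in> T"
    using z0 \<open>r > 0\<close> by (auto simp: T_def W_def)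
  then have "0 < s"
    using s(1) by (cases "s = 0") (auto simp: S_def \<gamma>_def)
  have in_T: "\<gamma> t \<in> T" if "0 \<le> t" "t < s" for t
    using that s by (force simp: S_def)
  \<comment> \<open>The distance that the Lipschitz bound allows the curve to travel. As it is less
    than \<open>r\<close>, the closed ball \<open>C\<close> about the start stays inside the open
    ball of radius \<open>2 * r\<close>.\<close>
  define \<eta> where "\<eta> = L * dist z0 z"
  have "\<eta> < r"
    using z \<open>L > 0\<close> by (simp add: \<eta>_def field_simps)
  define C where "C = {x \<in> fst c. snd c x \<in> cball (snd c (f z0)) \<eta>}"
  have sub: "cball (snd c (f z0)) \<eta> \<subseteq> ball p (2 * r)"
  proof
    fix q assume "q \<in> cball (snd c (f z0)) \<eta>"
    then show "q \<in> ball p (2 * r)"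
      using dist_triangle[of p q "snd c (f z0)"] z0(2) \<open>\<eta> < r\<close> by simp
  qed
  have "compactin X C"
    unfolding C_def using order_trans[OF sub order_trans[OF ball_subset_cball K]]
    by (intro compactin_chart_vimage[OF c] compact_cball)
  then have "closedin X C"
    using Hausdorff by (rule compactin_imp_closedin[rotated])
  then have "closed (f -` C)"
    using closedin_continuous_map_preimage[of euclidean X f C] f by (simp add: holomorphic_curve_def vimage_def)
  then have closed: "closed (\<gamma> -` (f -` C))"
    using cont by (intro closed_vimage)
  have in_C: "t \<in> \<gamma> -` (f -` C)" if t: "0 \<le> t" "t < s" for t
  proof -
    let ?S = "closed_segment z0 (\<gamma> t)"
    have "t \<le> 1"
      using t s(1) by (auto simp: S_def)
    have seg: "y \<in> T" if y: "y \<in> ?S" for y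
    proof -
      obtain u where u: "0 \<le> u" "u \<le> 1" "y = (1 - u) *\<^sub>R z0 + u *\<^sub>R \<gamma> t"
        using y by (auto simp: in_segment)
      have "y = \<gamma> (u * t)"
        using u(3) by (simp add: \<gamma>_def scaleR_conv_of_real algebra_simps)
      moreover have "u * t < s"
        using u t mult_left_le_one_le[of t u] by simp
      ultimately show ?thesis
        using in_T u(1) t(1) by simp
    qed
    have "norm (snd c (f (\<gamma> t)) - snd c (f z0)) \<le> L * norm (\<gamma> t - z0)"
      using seg
      by (intro curve_lipschitz_on_convex[OF f c, of ?S] L(2))
         (auto simp: T_def W_def less_imp_le)
    also have "norm (\<gamma> t - z0) = t * dist z0 z"
      using t by (simp add: \<gamma>_def norm_mult dist_norm norm_minus_commute)
    also have "L * (t * dist z0 z) \<le> \<eta>"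
      unfolding \<eta>_def using \<open>t \<le> 1\<close> t \<open>L > 0\<close> by (intro mult_left_mono mult_left_le_one_le) auto
    finally show ?thesis
      using in_T[OF t] by (simp add: C_def T_def W_def dist_norm norm_minus_commute)
  qed
  \<comment> \<open>Closedness of the preimage of \<open>C\<close> carries the bound to the time
    \<open>s\<close> itself, where the curve should have left \<open>T\<close>.\<close>
  have "closure {0..<s} \<subseteq> \<gamma> -` (f -` C)"
    using closed in_C by (intro closure_minimal) auto
  moreover have "s \<in> closure {0..<s}"
    using \<open>0 < s\<close> by (simp add: closure_atLeastLessThan)
  ultimately have "s \<in> \<gamma> -` (f -` C)"
    by blast
  then have "\<gamma> s \<in> T"
    using sub by (auto simp: C_def T_def W_def)
  then show False
    using s(1) by (simp add: S_def)
qed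

text \<open>Chart, compact set and Lipschitz constant form one value \<open>b\<close>, so that
  finitely many values can cover all curves and the pigeonhole principle can fix one along a
  subsequence. The compact \<open>K\<close> keeps limits inside the chart.\<close>

definition brody_chart :: "real \<Rightarrow> ('a, 'n) chart \<times> (complex^'n) set \<times> real \<Rightarrow> (complex \<Rightarrow> 'a) \<Rightarrow> complex \<Rightarrow> bool" where
  "brody_chart \<delta> b f z0 \<longleftrightarrow> (case b of (c, K, L) \<Rightarrow>
     c \<in> A \<and> compact K \<and> K \<subseteq> snd c ` fst c \<and>
     (\<forall>z\<in>cball z0 \<delta>. f z \<in> fst c \<and> snd c (f z) \<in> K) \<and>
     (\<forall>x\<in>cball z0 \<delta>. \<forall>y\<in>cball z0 \<delta>. norm (snd c (f x) - snd c (f y)) \<le> L * norm (x - y)))"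

lemma brody_chart_local:
  assumes x: "x \<in> topspace X"
  obtains V \<delta> b where "openin X V" "x \<in> V" "\<delta> > 0"
    "\<And>f z0. f \<in> brody_curves X A h \<Longrightarrow> f z0 \<in> V \<Longrightarrow> brody_chart \<delta> b f z0"
proof -
  obtain c where c: "c \<in> A" "x \<in> fst c"
    using x cover by blast
  define p where "p = snd c x"
  obtain e where e: "e > 0" "cball p e \<subseteq> snd c ` fst c"
    using open_chart_image[OF c(1)] c(2) unfolding p_def by (metis imageI open_contains_cball)
  define r where "r = e / 2"
  let ?K = "cball p (2 * r)"
  have r: "r > 0" and K: "?K \<subseteq> snd c ` fst c"
    using e by (auto simp: r_def)
  obtain L where L: "L > 0" "\<And>f z. f \<in> brody_curves X A h \<Longrightarrow> f z \<in> fst c \<Longrightarrow> snd c (f z) \<in> ?K \<Longrightarrow> norm (velocity c f z) \<le> L"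
    using brody_velocity_bound[OF c(1) compact_cball K] by blast
  \<comment> \<open>Half the trapping time, so that the closed disc of radius
    \<open>\<delta>\<close> lies in the open one of \<open>brody_trapped\<close>.\<close>
  define \<delta> where "\<delta> = r / L / 2"
  show thesis
  proof (rule that[of "{y \<in> fst c. snd c y \<in> ball p r}" \<delta> "(c, ?K, L)"])
    fix f z0 assume f: "f \<in> brody_curves X A h" and z0: "f z0 \<in> {y \<in> fst c. snd c y \<in> ball p r}"
    have hol: "holomorphic_curve X A f"
      using f by (simp add: brody_curves_def)
    have "z \<in> ball z0 (r / L)" if "z \<in> cball z0 \<delta>" for z
    proof -
      have "t / 2 < t" if "0 < t" for t :: real
        using that by simp
      from this[OF divide_pos_pos[OF r L(1)]] have "\<delta> < r / L"
        by (simp only: \<delta>_def)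
      then show ?thesis
        using that by simp
    qed
    then have trap: "f z \<in> fst c \<and> snd c (f z) \<in> ball p (2 * r)" if "z \<in> cball z0 \<delta>" for z
      using brody_trapped[OF c(1) K L(1) L(2)[OF f] hol] z0 that by blast
    then have in_K: "f z \<in> fst c" "snd c (f z) \<in> ?K" if "z \<in> cball z0 \<delta>" for z
      using that by (auto intro: less_imp_le)
    show "brody_chart \<delta> (c, ?K, L) f z0"
      unfolding brody_chart_def
      using in_K c(1) K L(2)[OF f] curve_lipschitz_on_convex[OF hol c(1) convex_cball[of z0 \<delta>]] by auto
  qed (use c r L(1) K openin_chart_vimage[OF c(1) open_ball[of p r]] in \<open>auto simp: p_def \<delta>_def\<close>)
qed

end

context compact_hermitian_manifold
begin

text \<open>A finite subcover of \<open>X\<close> leaves finitely many values \<open>b\<close>, and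
  \<open>brody_chart\<close> persists when its radius shrinks to the least one.\<close>

lemma uniform_brody_charts:
  obtains \<delta> \<B> where "\<delta> > 0" "finite \<B>"
    "\<And>f z0. f \<in> brody_curves X A h \<Longrightarrow> \<exists>b\<in>\<B>. brody_chart \<delta> b f z0"
proof -
  define good where "good V \<delta> b \<longleftrightarrow> \<delta> > 0 \<and>
    (\<forall>f z0. f \<in> brody_curves X A h \<longrightarrow> f z0 \<in> V \<longrightarrow> brody_chart \<delta> b f z0)" for V \<delta> b
  define \<V> where "\<V> = {V. openin X V \<and> (\<exists>\<delta> b. good V \<delta> b)}"
  have "topspace X \<subseteq> \<Union>\<V>"
  proof
    fix x assume "x \<in> topspace X"
    then obtain V \<delta> b where "openin X V" "x \<in> V" "good V \<delta> b"
      unfolding good_def by (rule brody_chart_local) blast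
    then show "x \<in> \<Union>\<V>"
      unfolding \<V>_def by blast
  qed
  then obtain \<F> where \<F>: "finite \<F>" "\<F> \<subseteq> \<V>" "topspace X \<subseteq> \<Union>\<F>"
    using compact unfolding compact_space_alt by (metis (no_types, lifting) \<V>_def mem_Collect_eq)
  have "\<forall>V\<in>\<F>. \<exists>q. good V (fst q) (snd q)"
    using \<F>(2) by (auto simp: \<V>_def)
  then obtain q where q: "\<And>V. V \<in> \<F> \<Longrightarrow> good V (fst (q V)) (snd (q V))"
    by metis
  \<comment> \<open>The inserted 1 keeps the minimum meaningful for an empty subcover.\<close>
  define \<delta> where "\<delta> = Min (insert 1 ((\<lambda>V. fst (q V)) ` \<F>))"
  show thesis
  proof (rule that[of \<delta> "(\<lambda>V. snd (q V)) ` \<F>"])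
    show "\<delta> > 0"
      unfolding \<delta>_def using \<F>(1) q by (subst Min_gr_iff) (auto simp: good_def)
    fix f z0 assume f: "f \<in> brody_curves X A h"
    then have "f z0 \<in> topspace X"
      by (simp add: brody_curves_def curve_in_manifold)
    then obtain V where V: "V \<in> \<F>" "f z0 \<in> V"
      using \<F>(3) by blast
    have "\<delta> \<le> fst (q V)"
      unfolding \<delta>_def using \<F>(1) V(1) by (intro Min_le) auto
    moreover have "brody_chart (fst (q V)) (snd (q V)) f z0"
      using q[OF V(1)] V(2) f by (simp add: good_def)
    ultimately have "brody_chart \<delta> (snd (q V)) f z0"
      unfolding brody_chart_def by (auto simp: subset_iff split: prod.splits)
    then show "\<exists>b\<in>(\<lambda>V. snd (q V)) ` \<F>. brody_chart \<delta> b f z0"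
      using V(1) by blast
  qed (use \<F>(1) in auto)
qed

end

section \<open>Convergence of Brody curves\<close>

context hermitian_manifold
begin

text \<open>The limit is only a map \<open>l\<close> in coordinates, since no limit curve exists
  before the diagonal subsequence is chosen.\<close>

definition converges_in_chart ::
  "(nat \<Rightarrow> complex \<Rightarrow> 'a) \<Rightarrow> real \<Rightarrow> complex \<Rightarrow> bool" where
  "converges_in_chart F \<delta> z0 \<longleftrightarrow> (\<exists>c K l. c \<in> A \<and> compact K \<and> K \<subseteq> snd c ` fst c \<and>
     (\<forall>\<^sub>F n in sequentially. \<forall>z\<in>cball z0 \<delta>. F n z \<in> fst c \<and> snd c (F n z) \<in> K) \<and>
     uniform_limit (cball z0 \<delta>) (\<lambda>n z. snd c (F n z)) l sequentially)"

definition chart_limit ::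
  "(nat \<Rightarrow> complex \<Rightarrow> 'a) \<Rightarrow> (complex \<Rightarrow> 'a) \<Rightarrow> real \<Rightarrow> ('a, 'n) chart \<Rightarrow> complex \<Rightarrow> bool" where
  "chart_limit F g \<delta> c z0 \<longleftrightarrow> c \<in> A \<and>
     (\<forall>\<^sub>F n in sequentially. \<forall>z\<in>cball z0 \<delta>. F n z \<in> fst c) \<and> (\<forall>z\<in>cball z0 \<delta>. g z \<in> fst c) \<and>
     uniform_limit (cball z0 \<delta>) (\<lambda>n z. snd c (F n z)) (\<lambda>z. snd c (g z)) sequentially"

definition locally_converges :: "(nat \<Rightarrow> complex \<Rightarrow> 'a) \<Rightarrow> (complex \<Rightarrow> 'a) \<Rightarrow> bool" where
  "locally_converges F g \<longleftrightarrow> (\<exists>\<delta>>0. \<forall>z. \<exists>z0 c. z \<in> ball z0 \<delta> \<and> chart_limit F g \<delta> c z0)"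

lemma converges_in_chart_subseq:
  assumes "strict_mono r" "converges_in_chart (\<lambda>n. F (s n)) \<delta> z0"
  shows "converges_in_chart (\<lambda>n. F ((s \<circ> r) n)) \<delta> z0"
proof -
  have r: "filterlim r sequentially sequentially"
    using assms(1) by (rule filterlim_subseq)
  obtain c K l where c: "c \<in> A" "compact K" "K \<subseteq> snd c ` fst c"
    and ev: "\<forall>\<^sub>F n in sequentially. \<forall>z\<in>cball z0 \<delta>. F (s n) z \<in> fst c \<and> snd c (F (s n) z) \<in> K"
    and lim: "uniform_limit (cball z0 \<delta>) (\<lambda>n z. snd c (F (s n) z)) l sequentially"
    using assms(2) unfolding converges_in_chart_def by (elim exE conjE)
  show ?thesis
    unfolding converges_in_chart_def o_def
    using c eventually_compose_filterlim[OF ev r] filterlim_compose[OF lim r]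
    by (intro exI[of _ c] exI[of _ K] exI[of _ l] conjI)
qed

text \<open>A diagonal sequence is a subsequence of the \<open>j\<close>-th one only beyond an
  initial segment.\<close>

lemma converges_in_chart_offset:
  assumes "converges_in_chart (\<lambda>n. F (n + k)) \<delta> z0"
  shows "converges_in_chart F \<delta> z0"
  using assms unfolding converges_in_chart_def uniform_limit_iff
    eventually_sequentially_seg[where P = "\<lambda>n. \<forall>z\<in>cball z0 \<delta>. dist (u (F n z)) (l z) < e" for u l e]
    eventually_sequentially_seg[where P = "\<lambda>n. \<forall>z\<in>cball z0 \<delta>. F n z \<in> U \<and> u (F n z) \<in> K" for u U K]
  .

text \<open>The coordinate limit stays in \<open>K\<close>, so the inverse chart turns it into a
  limit in \<open>X\<close>, which is unique because \<open>X\<close> is Hausdorff. Local limits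
  found in different charts thus fit together into one \<open>g\<close>.\<close>

lemma converges_in_chart_limit:
  assumes "converges_in_chart F \<delta> z0"
    and g: "\<And>z. z \<in> cball z0 \<delta> \<Longrightarrow> (\<exists>x. limitin X (\<lambda>n. F n z) x sequentially) \<Longrightarrow>
              limitin X (\<lambda>n. F n z) (g z) sequentially"
  obtains c where "chart_limit F g \<delta> c z0"
proof -
  obtain c K l where c: "c \<in> A" "compact K" "K \<subseteq> snd c ` fst c"
    and ev: "\<forall>\<^sub>F n in sequentially. \<forall>z\<in>cball z0 \<delta>. F n z \<in> fst c \<and> snd c (F n z) \<in> K"
    and lim: "uniform_limit (cball z0 \<delta>) (\<lambda>n z. snd c (F n z)) l sequentially"
    using assms(1) unfolding converges_in_chart_def by (elim exE conjE)
  let ?\<psi> = "the_inv_into (fst c) (snd c)"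
  have l: "g z \<in> fst c \<and> snd c (g z) = l z" if z: "z \<in> cball z0 \<delta>" for z
  proof -
    have tends: "(\<lambda>n. snd c (F n z)) \<longlonglongrightarrow> l z"
      using lim z by (rule tendsto_uniform_limitI)
    moreover have evz: "\<forall>\<^sub>F n in sequentially. F n z \<in> fst c \<and> snd c (F n z) \<in> K"
      using ev by (rule eventually_mono) (use z in blast)
    ultimately have "l z \<in> K"
      using c(2) by (intro Lim_in_closed_set[of K "\<lambda>n. snd c (F n z)" sequentially])
        (auto simp: compact_imp_closed elim: eventually_mono)
    then have img: "l z \<in> snd c ` fst c"
      using c(3) by (rule subsetD[rotated])
    then obtain x where x: "x \<in> fst c" "snd c x = l z"
      by (metis imageE)
    have "limitin (top_of_set (snd c ` fst c)) (\<lambda>n. snd c (F n z)) (l z) sequentially"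
      using tends img evz by (auto simp: limitin_subtopology elim: eventually_mono)
    then have "limitin X (?\<psi> \<circ> (\<lambda>n. snd c (F n z))) (?\<psi> (l z)) sequentially"
      using continuous_map_chart_inverse[OF c(1)] by (rule continuous_map_limit[rotated])
    then have "limitin X (\<lambda>n. F n z) (?\<psi> (l z)) sequentially"
      by (rule limitin_transform_eventually[rotated])
         (use evz in eventually_elim, simp add: the_inv_into_f_f[OF inj_on_chart[OF c(1)]])
    moreover have "?\<psi> (l z) = x"
      using the_inv_into_f_f[OF inj_on_chart[OF c(1)] x(1)] x(2) by simp
    ultimately have "limitin X (\<lambda>n. F n z) x sequentially"
      by simp
    with g[OF z] have "g z = x"
      using limitin_Hausdorff_unique[OF _ _ _ Hausdorff] by (metis sequentially_bot)
    then show ?thesis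
      using x by simp
  qed
  show thesis
  proof (rule that)
    have "uniform_limit (cball z0 \<delta>) (\<lambda>n z. snd c (F n z)) (\<lambda>z. snd c (g z)) sequentially"
      using l by (intro uniform_limit_cong'[THEN iffD1, OF _ _ lim]) auto
    moreover have "\<forall>\<^sub>F n in sequentially. \<forall>z\<in>cball z0 \<delta>. F n z \<in> fst c"
      using ev by (rule eventually_mono) blast
    ultimately show "chart_limit F g \<delta> c z0"
      using c(1) l unfolding chart_limit_def by blast
  qed
qed

text \<open>The pigeonhole principle puts infinitely many curves into one chart with one
  \<open>K\<close> and one \<open>L\<close>; Arzela-Ascoli applies there.\<close>

lemma convergent_subsequence_at:
  fixes F :: "nat \<Rightarrow> complex \<Rightarrow> 'a"
  assumes F: "\<And>n. \<exists>b\<in>\<B>. brody_chart \<delta> b (F n) z0" and "finite \<B>"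
  obtains r where "strict_mono r" "converges_in_chart (\<lambda>n. F (r n)) \<delta> z0"
proof -
  obtain b where b: "\<And>n. b n \<in> \<B>" "\<And>n. brody_chart \<delta> (b n) (F n) z0"
    using F by metis
  have "\<exists>n0. infinite {n. b n = b n0}"
    using pigeonhole_infinite[of "UNIV :: nat set" b] finite_subset[OF _ \<open>finite \<B>\<close>, of "range b"] b(1)
    by (auto simp: image_subset_iff)
  then obtain n0 where "infinite {n. b n = b n0}" ..
  from infinite_enumerate[OF this] obtain r :: "nat \<Rightarrow> nat"
    where r: "strict_mono r" "\<And>n. b (r n) = b n0"
    by blast
  obtain c K L where cKL: "b n0 = (c, K, L)"
    by (metis prod_cases3)
  have c: "c \<in> A" "compact K" "K \<subseteq> snd c ` fst c"
    using b(2)[of n0] by (auto simp: brody_chart_def cKL)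
  have Fr: "F (r n) z \<in> fst c" "snd c (F (r n) z) \<in> K" if "z \<in> cball z0 \<delta>" for n z
    using b(2)[of "r n"] that unfolding r(2) cKL brody_chart_def by auto
  have lip: "norm (snd c (F (r n) x) - snd c (F (r n) y)) \<le> L * norm (x - y)"
    if "x \<in> cball z0 \<delta>" "y \<in> cball z0 \<delta>" for n x y
    using b(2)[of "r n"] that unfolding r(2) cKL brody_chart_def by auto
  obtain M where M: "\<And>p. p \<in> K \<Longrightarrow> norm p \<le> M"
    using compact_imp_bounded[OF c(2)] by (auto simp: bounded_iff)
  obtain l k where k: "strict_mono (k :: nat \<Rightarrow> nat)"
    and l: "\<And>e. 0 < e \<Longrightarrow> \<exists>N. \<forall>n x. n \<ge> N \<and> x \<in> cball z0 \<delta> \<longrightarrow> norm (snd c (F (r (k n)) x) - l x) < e"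
  proof (rule Arzela_Ascoli[of "cball z0 \<delta>" "\<lambda>n z. snd c (F (r n) z)" M])
    fix x e assume x: "x \<in> cball z0 \<delta>" and "(0::real) < e"
    \<comment> \<open>\<open>brody_chart\<close> says nothing about the sign of \<open>L\<close>;
      the denominator is positive in any case.\<close>
    define d where "d = e / (\<bar>L\<bar> + 1)"
    have "norm (snd c (F (r n) x) - snd c (F (r n) y)) < e" if "y \<in> cball z0 \<delta>" "norm (x - y) < d" for n y
    proof -
      have "L * norm (x - y) \<le> (\<bar>L\<bar> + 1) * norm (x - y)"
        by (intro mult_right_mono) auto
      also have "\<dots> < e"
        using that(2) by (simp add: d_def field_simps)
      finally show ?thesis
        using lip[OF x that(1), of n] by linarith
    qed
    moreover have "d > 0"
      using \<open>e > 0\<close> by (simp add: d_def)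
    ultimately show "\<exists>d>0. \<forall>n y. y \<in> cball z0 \<delta> \<and> norm (x - y) < d \<longrightarrow>
        norm (snd c (F (r n) x) - snd c (F (r n) y)) < e"
      by blast
  qed (use Fr M in auto)
  have "uniform_limit (cball z0 \<delta>) (\<lambda>n z. snd c (F ((r \<circ> k) n) z)) l sequentially"
    unfolding uniform_limit_iff eventually_sequentially dist_norm o_def using l by blast
  then have "converges_in_chart (\<lambda>n. F ((r \<circ> k) n)) \<delta> z0"
    unfolding converges_in_chart_def using c Fr by (intro exI[of _ c] exI[of _ K] exI[of _ l]) auto
  moreover have "strict_mono (r \<circ> k)"
    using r(1) k by (rule strict_mono_o)
  ultimately show thesis
    using that by blast
qed

end

text \<open>As \<open>\<delta>\<close> does not depend on the centre, discs of this radius about a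
  countable dense set cover the plane, and a diagonal subsequence converges on all of them.\<close>

lemma (in compact_hermitian_manifold) brody_convergent_subsequence:
  assumes F: "\<And>n. F n \<in> brody_curves X A h"
  obtains s g where "strict_mono (s :: nat \<Rightarrow> nat)" "locally_converges (\<lambda>n. F (s n)) g"
proof -
  obtain \<delta> \<B> where \<delta>: "\<delta> > 0" "finite \<B>"
    "\<And>f z0. f \<in> brody_curves X A h \<Longrightarrow> \<exists>b\<in>\<B>. brody_chart \<delta> b f z0"
    using uniform_brody_charts by blast
  obtain D :: "complex set" where D: "countable D" "\<And>U. open U \<Longrightarrow> U \<noteq> {} \<Longrightarrow> \<exists>d\<in>D. d \<in> U"
    using countable_dense_exists by blast
  have "D \<noteq> {}"
    using D(2)[of UNIV] by auto
  define q where "q = from_nat_into D"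
  interpret subseqs "\<lambda>j s. converges_in_chart (\<lambda>n. F (s n)) \<delta> (q j)"
  proof
    fix j and s :: "nat \<Rightarrow> nat"
    obtain r where "strict_mono r" "converges_in_chart (\<lambda>n. F (s (r n))) \<delta> (q j)"
      using convergent_subsequence_at[of \<B> \<delta> "\<lambda>n. F (s n)" "q j"] \<delta>(2,3) F by blast
    then show "\<exists>r. strict_mono r \<and> converges_in_chart (\<lambda>n. F ((s \<circ> r) n)) \<delta> (q j)"
      by auto
  qed
  have conv: "converges_in_chart (\<lambda>n. F (diagseq n)) \<delta> (q j)" for j
  proof (rule converges_in_chart_offset)
    have "converges_in_chart (\<lambda>n. F ((diagseq \<circ> (+) (Suc j)) n)) \<delta> (q j)"
      by (rule diagseq_holds) (rule converges_in_chart_subseq)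
    then show "converges_in_chart (\<lambda>n. F (diagseq (n + Suc j))) \<delta> (q j)"
      by (simp add: o_def add.commute)
  qed
  \<comment> \<open>The choice is arbitrary where no limit exists; convergence in the charts shows
    that there is no such point.\<close>
  define g where "g z = (SOME x. limitin X (\<lambda>n. F (diagseq n) z) x sequentially)" for z
  have g: "(\<exists>x. limitin X (\<lambda>n. F (diagseq n) z) x sequentially) \<Longrightarrow>
      limitin X (\<lambda>n. F (diagseq n) z) (g z) sequentially" for z
    unfolding g_def by (rule someI_ex)
  have "\<exists>z0 c. z \<in> ball z0 \<delta> \<and> chart_limit (\<lambda>n. F (diagseq n)) g \<delta> c z0" for z
  proof -
    obtain d where "d \<in> D" "d \<in> ball z \<delta>"
      using D(2)[of "ball z \<delta>"] \<delta>(1) by auto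
    moreover obtain j where "q j = d"
      using from_nat_into_surj[OF D(1) \<open>d \<in> D\<close>] unfolding q_def by blast
    ultimately have "z \<in> ball (q j) \<delta>"
      by (simp add: dist_commute)
    moreover obtain c where "chart_limit (\<lambda>n. F (diagseq n)) g \<delta> c (q j)"
      using converges_in_chart_limit[OF conv g] by blast
    ultimately show ?thesis
      by blast
  qed
  then show thesis
    using that[OF subseq_diagseq] \<delta>(1) unfolding locally_converges_def by blast
qed

section \<open>Continuity, holomorphy and compact-open convergence tested locally\<close>

context complex_manifold
begin

lemma continuous_map_via_charts:
  assumes "\<And>z. \<exists>U. \<exists>c\<in>A. open U \<and> z \<in> U \<and> g ` U \<subseteq> fst c \<and> continuous_on U (\<lambda>w. snd c (g w))"
  shows "continuous_map euclidean X g"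
  unfolding continuous_map_def
proof (intro conjI allI impI)
  show "g \<in> topspace euclidean \<rightarrow> topspace X"
  proof
    fix z
    obtain U c where "c \<in> A" "z \<in> U" "g ` U \<subseteq> fst c"
      using assms[of z] by blast
    then show "g z \<in> topspace X"
      using cover by blast
  qed
next
  fix V assume V: "openin X V"
  have "open {z. g z \<in> V}"
    unfolding open_subopen[of "{z. g z \<in> V}"]
  proof
    fix z assume "z \<in> {z. g z \<in> V}"
    then have z: "g z \<in> V"
      by simp
    obtain U c where U: "open U" "z \<in> U" "g ` U \<subseteq> fst c" and c: "c \<in> A"
      and cont: "continuous_on U (\<lambda>w. snd c (g w))"
      using assms[of z] by blast
    define T where "T = U \<inter> (\<lambda>w. snd c (g w)) -` (snd c ` (V \<inter> fst c))"
    have "open T"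
      unfolding T_def using cont U(1) open_chart_image_subset[OF c V] by (rule continuous_open_preimage)
    moreover have "z \<in> T"
      using z U by (auto simp: T_def)
    moreover have "T \<subseteq> {z. g z \<in> V}"
    proof
      fix w assume "w \<in> T"
      then obtain v where v: "v \<in> V" "v \<in> fst c" "snd c (g w) = snd c v" and "g w \<in> fst c"
        using U(3) unfolding T_def by blast
      then have "g w = v"
        using inj_on_chart[OF c] by (auto dest: inj_onD)
      then show "w \<in> {z. g z \<in> V}"
        using v by simp
    qed
    ultimately show "\<exists>T. open T \<and> z \<in> T \<and> T \<subseteq> {z. g z \<in> V}"
      by blast
  qed
  then show "openin euclidean {z \<in> topspace euclidean. g z \<in> V}"
    by simp
qed

text \<open>A holomorphic curve must be holomorphic in every chart of the atlas, while a limit is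
  controlled in one chart near each point. The complex linear derivative of the transition maps
  bridges the two.\<close>

lemma holomorphic_curve_via_charts:
  assumes "\<And>z. \<exists>U. \<exists>c\<in>A. open U \<and> z \<in> U \<and> g ` U \<subseteq> fst c \<and>
             (\<forall>i. (\<lambda>w. snd c (g w) $ i) holomorphic_on U)"
  shows "holomorphic_curve X A g"
proof -
  have cont: "continuous_map euclidean X g"
  proof (rule continuous_map_via_charts)
    fix z
    obtain U c where U: "open U" "z \<in> U" "g ` U \<subseteq> fst c" "c \<in> A"
      and hol: "\<And>i. (\<lambda>w. snd c (g w) $ i) holomorphic_on U"
      using assms[of z] by blast
    have "continuous_on U (\<lambda>w. \<chi> i. snd c (g w) $ i)"
      using hol by (intro continuous_on_vec_lambda holomorphic_on_imp_continuous_on)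
    then show "\<exists>U. \<exists>c\<in>A. open U \<and> z \<in> U \<and> g ` U \<subseteq> fst c \<and> continuous_on U (\<lambda>w. snd c (g w))"
      using U by (intro exI[of _ U] bexI[of _ c]) auto
  qed
  have "(\<lambda>w. snd d (g w) $ i) field_differentiable at z" if d: "d \<in> A" "g z \<in> fst d" for d i z
  proof -
    obtain U c where U: "open U" "z \<in> U" "g ` U \<subseteq> fst c" and c: "c \<in> A"
      and hol: "\<And>i. (\<lambda>w. snd c (g w) $ i) holomorphic_on U"
      using assms[of z] by blast
    have z: "g z \<in> fst c \<inter> fst d"
      using U d by auto
    define v where "v = (\<chi> i. deriv (\<lambda>w. snd c (g w) $ i) z)"
    have v: "((\<lambda>w. snd c (g w)) has_derivative (\<lambda>u. u *s v)) (at z)"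
      unfolding v_def using hol U
      by (intro has_derivative_vec_deriv holomorphic_on_imp_differentiable_at) auto
    obtain D where D: "(transition c d has_derivative D) (at (snd c (g z)))"
      and lin: "\<And>a v. D (a *s v) = a *s D v"
      by (rule transition_has_derivative[OF c d(1) z]) (rule that)
    from v D have "((\<lambda>w. transition c d (snd c (g w))) has_derivative (\<lambda>u. D (u *s v))) (at z)"
      by (rule has_derivative_compose)
    moreover have "\<forall>\<^sub>F w in at z. transition c d (snd c (g w)) = snd d (g w)"
      and "transition c d (snd c (g z)) = snd d (g z)"
      using eventually_transition[OF cont c d(1) z] by (auto simp: eventually_nhds_conv_at)
    ultimately have "((\<lambda>w. snd d (g w)) has_derivative (\<lambda>u. D (u *s v))) (at z)"
      by (rule has_derivative_transform_eventually) auto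
    then have "((\<lambda>w. snd d (g w) $ i) has_derivative (\<lambda>u. D (u *s v) $ i)) (at z)"
      by (rule bounded_linear.has_derivative[OF bounded_linear_vec_nth])
    then have "((\<lambda>w. snd d (g w) $ i) has_field_derivative D v $ i) (at z)"
      by (simp add: has_field_derivative_def lin mult.commute[of _ "D v $ i"])
    then show ?thesis
      by (auto simp: field_differentiable_def)
  qed
  then show ?thesis
    using cont unfolding holomorphic_curve_def holomorphic_on_def
    by (auto intro: field_differentiable_at_within)
qed

text \<open>Being eventually in a neighbourhood passes to finite intersections and arbitrary unions,
  so the subbasic sets suffice.\<close>

lemma limitin_compact_open:
  assumes g: "continuous_map euclidean X g"
    and ev: "\<And>K U. compact K \<Longrightarrow> openin X U \<Longrightarrow> g ` K \<subseteq> U \<Longrightarrow>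
              \<forall>\<^sub>F n in G. continuous_map euclidean X (F n) \<and> F n ` K \<subseteq> U"
  shows "limitin (compact_open_topology euclidean X) F g G"
proof -
  let ?S = "{{f. continuous_map euclidean X f \<and> f ` K \<subseteq> U} | K U. compactin euclidean K \<and> openin X U}"
  have *: "g \<in> W \<Longrightarrow> \<forall>\<^sub>F n in G. F n \<in> W" if "generate_topology_on ?S W" for W
    using that
  proof (induction rule: generate_topology_on.induct)
    case (Int a b)
    then show ?case
      by (auto simp: eventually_conj_iff)
  next
    case (UN K)
    then obtain W where "W \<in> K" "g \<in> W"
      by blast
    then have "\<forall>\<^sub>F n in G. F n \<in> W"
      using UN by blast
    then show ?case
      by (rule eventually_mono) (use \<open>W \<in> K\<close> in blast)
  next
    case (Basis s)
    then obtain K U where "s = {f. continuous_map euclidean X f \<and> f ` K \<subseteq> U}" "compact K" "openin X U"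
      by auto
    then show ?case
      using ev[of K U] Basis by auto
  qed simp
  \<comment> \<open>With \<open>K\<close> and \<open>U\<close> empty, the subbasic set contains
    every continuous map, which puts \<open>g\<close> into the underlying space.\<close>
  have "{f. continuous_map euclidean X f \<and> f ` {} \<subseteq> {}} \<in> ?S"
    by (rule CollectI, rule exI[of _ "{}"], rule exI[of _ "{}"]) auto
  then have "g \<in> \<Union>?S"
    using g by (intro UnionI) auto
  then show ?thesis
    using * unfolding limitin_def compact_open_topology_def openin_topology_generated_by_iff
      topology_generated_by_topspace
    by blast
qed

end

section \<open>Properties that pass to the limit curve\<close>

context hermitian_manifold
begin

lemma chart_limit_component:
  assumes lim: "chart_limit F g \<delta> c z0" and F: "\<And>n. holomorphic_curve X A (F n)"
  shows "uniform_limit (cball z0 \<delta>) (\<lambda>n w. snd c (F n w) $ i) (\<lambda>w. snd c (g w) $ i) sequentially"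
    and "\<forall>\<^sub>F n in sequentially. continuous_on (cball z0 \<delta>) (\<lambda>w. snd c (F n w) $ i) \<and>
           (\<lambda>w. snd c (F n w) $ i) holomorphic_on ball z0 \<delta>"
proof -
  show "uniform_limit (cball z0 \<delta>) (\<lambda>n w. snd c (F n w) $ i) (\<lambda>w. snd c (g w) $ i) sequentially"
    using lim unfolding chart_limit_def
    by (auto intro: bounded_linear.uniform_limit[OF bounded_linear_vec_nth])
  have c: "c \<in> A" and "\<forall>\<^sub>F n in sequentially. \<forall>z\<in>cball z0 \<delta>. F n z \<in> fst c"
    using lim by (auto simp: chart_limit_def)
  from this(2) show "\<forall>\<^sub>F n in sequentially. continuous_on (cball z0 \<delta>) (\<lambda>w. snd c (F n w) $ i) \<and>
      (\<lambda>w. snd c (F n w) $ i) holomorphic_on ball z0 \<delta>"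
  proof eventually_elim
    case (elim n)
    then have "(\<lambda>w. snd c (F n w) $ i) holomorphic_on cball z0 \<delta>"
      by (intro holomorphic_on_subset[OF holomorphic_curve_component[OF F c]]) auto
    then show ?case
      by (meson ball_subset_cball holomorphic_on_imp_continuous_on holomorphic_on_subset)
  qed
qed

lemma chart_limit_holomorphic:
  assumes "chart_limit F g \<delta> c z0" "\<And>n. holomorphic_curve X A (F n)"
  shows "(\<lambda>w. snd c (g w) $ i) holomorphic_on ball z0 \<delta>"
  by (rule holomorphic_uniform_limit[OF chart_limit_component(2,1)[OF assms]]) auto

lemma chart_limit_continuous:
  assumes "chart_limit F g \<delta> c z0" "\<And>n. holomorphic_curve X A (F n)"
  shows "continuous_on (ball z0 \<delta>) (\<lambda>w. snd c (g w))"
proof -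
  have "continuous_on (ball z0 \<delta>) (\<lambda>w. \<chi> i. snd c (g w) $ i)"
    using chart_limit_holomorphic[OF assms]
    by (intro continuous_on_vec_lambda holomorphic_on_imp_continuous_on)
  then show ?thesis
    by simp
qed

text \<open>\<open>chart_limit\<close> controls values only; the Weierstrass theorem for holomorphic
  functions supplies the derivatives.\<close>

lemma chart_limit_tendsto_velocity:
  assumes "chart_limit F g \<delta> c z0" "\<And>n. holomorphic_curve X A (F n)" "z \<in> ball z0 \<delta>"
  shows "(\<lambda>n. velocity c (F n) z) \<longlonglongrightarrow> velocity c g z"
  unfolding velocity_def
proof (intro tendsto_vec_lambda)
  fix i
  show "(\<lambda>n. deriv (\<lambda>z. snd c (F n z) $ i) z) \<longlonglongrightarrow> deriv (\<lambda>z. snd c (g z) $ i) z"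
  proof (rule deriv_complex_uniform_limit[OF _ _ _ open_ball \<open>z \<in> ball z0 \<delta>\<close>])
    show "uniform_limit (ball z0 \<delta>) (\<lambda>n w. snd c (F n w) $ i) (\<lambda>w. snd c (g w) $ i) sequentially"
      using chart_limit_component(1)[OF assms(1,2)] ball_subset_cball by (rule uniform_limit_on_subset)
    show "\<forall>\<^sub>F n in sequentially. (\<lambda>w. snd c (F n w) $ i) holomorphic_on ball z0 \<delta>"
      using chart_limit_component(2)[OF assms(1,2)] by (rule eventually_mono) blast
  qed simp
qed

lemma locally_convergesE:
  assumes "locally_converges F g"
  obtains \<delta> z0 c where "z \<in> ball z0 \<delta>" "c \<in> A" "chart_limit F g \<delta> c z0"
  using assms unfolding locally_converges_def chart_limit_def by blast

lemma locally_converges_holomorphic: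
  assumes lim: "locally_converges F g" and F: "\<And>n. holomorphic_curve X A (F n)"
  shows "holomorphic_curve X A g"
proof (rule holomorphic_curve_via_charts)
  fix z
  obtain \<delta> z0 c where c: "z \<in> ball z0 \<delta>" "c \<in> A" "chart_limit F g \<delta> c z0"
    using lim by (rule locally_convergesE)
  show "\<exists>U. \<exists>c\<in>A. open U \<and> z \<in> U \<and> g ` U \<subseteq> fst c \<and> (\<forall>i. (\<lambda>w. snd c (g w) $ i) holomorphic_on U)"
    using c chart_limit_holomorphic[OF c(3) F]
    by (intro exI[of _ "ball z0 \<delta>"] bexI[of _ c]) (auto simp: chart_limit_def)
qed

lemma locally_converges_spherical_derivative_sq:
  assumes lim: "locally_converges F g" and F: "\<And>n. holomorphic_curve X A (F n)"
  shows "(\<lambda>n. (spherical_derivative A h (F n) z)\<^sup>2) \<longlonglongrightarrow> (spherical_derivative A h g z)\<^sup>2"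
proof -
  obtain \<delta> z0 c where z: "z \<in> ball z0 \<delta>" and c: "c \<in> A" and cl: "chart_limit F g \<delta> c z0"
    using lim by (rule locally_convergesE)
  have gz: "g z \<in> fst c" and ev: "\<forall>\<^sub>F n in sequentially. F n z \<in> fst c"
    and ul: "uniform_limit (cball z0 \<delta>) (\<lambda>n z. snd c (F n z)) (\<lambda>z. snd c (g z)) sequentially"
    using cl z unfolding chart_limit_def by (auto elim!: eventually_mono)
  have "(\<lambda>n. snd c (F n z)) \<longlonglongrightarrow> snd c (g z)"
    using ul by (rule tendsto_uniform_limitI) (use z in auto)
  then have "(\<lambda>n. chart_speed_sq h c (F n) z) \<longlonglongrightarrow> chart_speed_sq h c g z"
    unfolding chart_speed_sq_def[of h c g z]
    using tendsto_chart_speed_sq[OF c gz ev _ chart_limit_tendsto_velocity[OF cl F z]] by blast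
  then have "(\<lambda>n. chart_speed_sq h c (F n) z) \<longlonglongrightarrow> (spherical_derivative A h g z)\<^sup>2"
    using spherical_derivative_sq[OF locally_converges_holomorphic[OF lim F] c gz] by simp
  then show ?thesis
    by (rule tendsto_cong[THEN iffD1, rotated])
       (use ev in eventually_elim, simp add: spherical_derivative_sq[OF F c])
qed

lemma spherical_derivative_nonneg:
  assumes "holomorphic_curve X A f"
  shows "0 \<le> spherical_derivative A h f z"
  using curve_in_chart[OF assms, of z] spherical_derivative_eq[OF assms] chart_speed_sq_nonneg
  by force

lemma brody_speed_sq_le_1:
  assumes "f \<in> brody_curves X A h"
  shows "(spherical_derivative A h f z)\<^sup>2 \<le> 1"
  using assms spherical_derivative_nonneg[of f z] by (auto simp: brody_curves_def power_le_one)

lemma locally_converges_brody: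
  assumes lim: "locally_converges F g" and F: "\<And>n. F n \<in> brody_curves X A h"
  shows "g \<in> brody_curves X A h"
proof -
  have hol: "holomorphic_curve X A (F n)" for n
    using F by (simp add: brody_curves_def)
  have g: "holomorphic_curve X A g"
    using lim hol by (rule locally_converges_holomorphic)
  have "spherical_derivative A h g z \<le> 1" for z
  proof -
    have "(spherical_derivative A h g z)\<^sup>2 \<le> 1"
      using brody_speed_sq_le_1[OF F]
      by (intro tendsto_upperbound[OF locally_converges_spherical_derivative_sq[OF lim hol]]) auto
    then show ?thesis
      using power2_le_imp_le[of "spherical_derivative A h g z" 1] by simp
  qed
  then show ?thesis
    using g by (simp add: brody_curves_def)
qed

text \<open>Closedness of \<open>N\<close> refers to the compact-open topology, while extraction
  yields convergence in charts. Near each point of \<open>K\<close>, oscillation of \<open>g\<close>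
  and uniform error each take \<open>e / 2\<close>; compactness leaves finitely many
  neighbourhoods.\<close>

lemma locally_converges_compact_open:
  assumes lim: "locally_converges F g" and F: "\<And>n. holomorphic_curve X A (F n)"
  shows "limitin (compact_open_topology euclidean X) F g sequentially"
proof (rule limitin_compact_open)
  show "continuous_map euclidean X g"
    using locally_converges_holomorphic[OF lim F] by (simp add: holomorphic_curve_def)
next
  fix K U assume K: "compact K" and U: "openin X U" and gK: "g ` K \<subseteq> U"
  have "\<exists>T. open T \<and> z \<in> T \<and> (\<forall>\<^sub>F n in sequentially. F n ` T \<subseteq> U)" if "z \<in> K" for z
  proof -
    obtain \<delta> z0 c where z: "z \<in> ball z0 \<delta>" and c: "c \<in> A" and cl: "chart_limit F g \<delta> c z0"
      using lim by (rule locally_convergesE)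
    define O' where "O' = snd c ` (U \<inter> fst c)"
    have "open O'"
      unfolding O'_def using c U by (rule open_chart_image_subset)
    moreover have "snd c (g z) \<in> O'"
      using cl z that gK by (auto simp: O'_def chart_limit_def)
    ultimately obtain e where e: "e > 0" "ball (snd c (g z)) e \<subseteq> O'"
      by (meson open_contains_ball)
    define T where "T = ball z0 \<delta> \<inter> (\<lambda>w. snd c (g w)) -` ball (snd c (g z)) (e / 2)"
    have "open T"
      unfolding T_def using chart_limit_continuous[OF cl F] by (rule continuous_open_preimage) auto
    moreover have "z \<in> T"
      using z e(1) by (simp add: T_def)
    moreover have "\<forall>\<^sub>F n in sequentially. F n ` T \<subseteq> U"
    proof -
      have "\<forall>\<^sub>F n in sequentially. \<forall>w\<in>cball z0 \<delta>. F n w \<in> fst c"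
        and "\<forall>\<^sub>F n in sequentially. \<forall>w\<in>cball z0 \<delta>. dist (snd c (F n w)) (snd c (g w)) < e / 2"
        using cl half_gt_zero[OF e(1)] unfolding chart_limit_def uniform_limit_iff by blast+
      then show ?thesis
      proof eventually_elim
        case (elim n)
        show ?case
        proof (rule image_subsetI)
          fix w assume w: "w \<in> T"
          then have "w \<in> cball z0 \<delta>" "dist (snd c (g z)) (snd c (g w)) < e / 2"
            by (auto simp: T_def)
          with elim have in_c: "F n w \<in> fst c" and "dist (snd c (F n w)) (snd c (g w)) < e / 2"
            by auto
          then have "snd c (F n w) \<in> ball (snd c (g z)) e"
            using dist_triangle2[of "snd c (g z)" "snd c (F n w)" "snd c (g w)"]
              \<open>dist (snd c (g z)) (snd c (g w)) < e / 2\<close> by simp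
          then have "snd c (F n w) \<in> O'"
            using e(2) by (rule subsetD[rotated])
          then show "F n w \<in> U"
            using in_c inj_on_chart[OF c] unfolding O'_def by (auto dest: inj_onD)
        qed
      qed
    qed
    ultimately show ?thesis
      by blast
  qed
  then obtain T where T: "\<And>z. z \<in> K \<Longrightarrow> open (T z) \<and> z \<in> T z \<and> (\<forall>\<^sub>F n in sequentially. F n ` T z \<subseteq> U)"
    by metis
  then have "K \<subseteq> (\<Union>z\<in>K. T z)"
    by blast
  then obtain P where P: "P \<subseteq> K" "finite P" "K \<subseteq> (\<Union>z\<in>P. T z)"
    using compactE_image[OF K, of K T] T by blast
  have "\<forall>\<^sub>F n in sequentially. \<forall>z\<in>P. F n ` T z \<subseteq> U"
    using P T by (intro eventually_ball_finite) auto
  then show "\<forall>\<^sub>F n in sequentially. continuous_map euclidean X (F n) \<and> F n ` K \<subseteq> U"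
  proof eventually_elim
    case (elim n)
    have "F n ` K \<subseteq> (\<Union>z\<in>P. F n ` T z)"
      using P(3) by blast
    also have "\<dots> \<subseteq> U"
      using elim by blast
    finally show ?case
      using F[of n] by (simp add: holomorphic_curve_def)
  qed
qed

end

theorem theorem1p3:
  fixes X :: "'a topology" and A :: "('a, 'n::finite) chart set"
    and h :: "('a, 'n) chart \<Rightarrow> complex^'n \<Rightarrow> complex^'n^'n"
    and N :: "(complex \<Rightarrow> 'a) set"
  assumes "compact_hermitian_manifold X A h"
    and "closedin (brody_space X A h) N"
    and "translation_invariant N"
  shows "((\<lambda>R::real. ennreal (1 / (pi * R\<^sup>2)) * (SUP f\<in>N. energy A h f (ball 0 R)))
           \<longlongrightarrow> energy_density_set A h N) at_top"
proof -
  interpret compact_hermitian_manifold X A h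
    by fact
  define e where "e f z = (spherical_derivative A h f z)\<^sup>2" for f z
  define F where "F = e ` N"
  have brody: "f \<in> brody_curves X A h" if "f \<in> N" for f
    using closedin_subset[OF assms(2)] that unfolding brody_space_def by auto
  then have hol: "holomorphic_curve X A f" if "f \<in> N" for f
    using that by (auto simp: brody_curves_def)
  have meas: "e f \<in> borel_measurable borel" if "f \<in> N" for f
    using continuous_spherical_derivative_sq[OF hol[OF that]] unfolding e_def
    by (rule borel_measurable_continuous_onI)
  have nonneg: "0 \<le> e f z" for f z
    by (simp add: e_def)
  have le_1: "e f z \<le> 1" if "f \<in> N" for f z
    unfolding e_def using brody[OF that] by (rule brody_speed_sq_le_1)
  have shift_in: "(\<lambda>z. f (z + a)) \<in> N" if "f \<in> N" for f a
    using assms(3) that by (simp add: translation_invariant_def)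
  have shift: "e (\<lambda>z. f (z + a)) = (\<lambda>z. e f (z + a))" if f: "f \<in> N" for f a
  proof
    fix z
    obtain c where c: "c \<in> A" "f (z + a) \<in> fst c"
      using curve_in_chart[OF hol[OF f]] by blast
    then show "e (\<lambda>z. f (z + a)) z = e f (z + a)"
      unfolding e_def using hol[OF f] hol[OF shift_in[OF f]]
      by (simp add: spherical_derivative_sq[of _ c] chart_speed_sq_shift)
  qed
  have seq_compact: "\<exists>g\<in>F. \<exists>s. strict_mono s \<and> (\<forall>z. (\<lambda>n. E (s n) z) \<longlonglongrightarrow> g z)"
    if E: "\<And>n. E n \<in> F" for E :: "nat \<Rightarrow> complex \<Rightarrow> real"
  proof -
    obtain f where f: "\<And>n. f n \<in> N" "\<And>n. E n = e (f n)"
      using E unfolding F_def image_iff by metis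
    obtain s g where s: "strict_mono s" and lim: "locally_converges (\<lambda>n. f (s n)) g"
      using brody_convergent_subsequence[of f] brody f(1) by blast
    \<comment> \<open>The limit is a Brody curve, so convergence holds in the subspace in which
      \<open>N\<close> is closed.\<close>
    have "limitin (brody_space X A h) (\<lambda>n. f (s n)) g sequentially"
      using locally_converges_compact_open[OF lim] locally_converges_brody[OF lim] brody hol f(1)
      by (auto simp: brody_space_def limitin_subtopology)
    then have "g \<in> N"
      using limitin_closedin[of "brody_space X A h" "\<lambda>n. f (s n)" g sequentially N] assms(2) f(1) by simp
    moreover have "(\<lambda>n. E (s n) z) \<longlonglongrightarrow> e g z" for z
      using locally_converges_spherical_derivative_sq[OF lim hol[OF f(1)]] unfolding f(2) e_def .
    ultimately show ?thesis
      using s unfolding F_def by blast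
  qed
  have energy: "energy A h f S = (\<integral>\<^sup>+z\<in>S. ennreal (e f z) \<partial>lborel)" for f S
    by (simp add: energy_def e_def)
  \<comment> \<open>\<open>Lim\<close> denotes the actual limit only once convergence is
    proved.\<close>
  have "energy_density A h f = lim_disc_density {e f}" if "f \<in> N" for f
  proof -
    have "(sup_disc_density {e f} \<longlongrightarrow> lim_disc_density {e f}) at_top"
      using meas[OF that] le_1[OF that] by (intro tendsto_lim_disc_density) auto
    then show ?thesis
      unfolding energy_density_def by (intro tendsto_Lim) (simp_all add: energy sup_disc_density_def[abs_def])
  qed
  then have "energy_density_set A h N = (SUP g\<in>F. lim_disc_density {g})"
    unfolding energy_density_set_def F_def by (simp add: image_image)
  also have "\<dots> = lim_disc_density F"
    using meas nonneg le_1 shift shift_in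
    by (intro lim_disc_density_attained[symmetric] seq_compact) (auto simp: F_def image_iff, metis)
  finally have density: "energy_density_set A h N = lim_disc_density F" .
  have sup: "(SUP f\<in>N. energy A h f (ball 0 R)) = (SUP g\<in>F. SUP a. \<integral>\<^sup>+z\<in>ball a R. ennreal (g z) \<partial>lborel)" for R
  proof (rule antisym)
    show "(SUP f\<in>N. energy A h f (ball 0 R)) \<le> (SUP g\<in>F. SUP a. \<integral>\<^sup>+z\<in>ball a R. ennreal (g z) \<partial>lborel)"
      unfolding F_def image_image energy by (intro SUP_subset_mono order_refl SUP_upper2[of 0]) auto
  next
    have "(\<integral>\<^sup>+z\<in>ball a R. ennreal (e f z) \<partial>lborel) \<le> (SUP f\<in>N. energy A h f (ball 0 R))" if f: "f \<in> N" for f a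
    proof -
      have "(\<integral>\<^sup>+z\<in>ball a R. ennreal (e f z) \<partial>lborel) = energy A h (\<lambda>z. f (z + a)) (ball 0 R)"
        unfolding energy shift[OF f]
        using disc_integral_shift[of "\<lambda>z. ennreal (e f z)", where a = 0 and p = a and R = R] meas[OF f] by simp
      also have "\<dots> \<le> (SUP f\<in>N. energy A h f (ball 0 R))"
        using shift_in[OF f] by (rule SUP_upper)
      finally show ?thesis .
    qed
    then show "(SUP g\<in>F. SUP a. \<integral>\<^sup>+z\<in>ball a R. ennreal (g z) \<partial>lborel) \<le> (SUP f\<in>N. energy A h f (ball 0 R))"
      unfolding F_def by (intro SUP_least) auto
  qed
  have "(sup_disc_density F \<longlongrightarrow> lim_disc_density F) at_top"
    using meas le_1 by (intro tendsto_lim_disc_density) (auto simp: F_def)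
  then show ?thesis
    by (simp add: density sup sup_disc_density_def[abs_def])
qed

end
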